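(* Let $f\in\mathfrak{X}^r_{\mathrm{Byk}}(\mathbf{S}^3)$, $r\ge 3$, with flow $\varphi$, equilibria $\sigma_1,\sigma_2$, Bykov attractor $\mathcal{A}_f$ and basin $\mathcal{B}(\mathcal{A}_f)$. Given a continuous map $G\colon \mathbf{S}^3\to\mathbb{R}$ and $P\in\mathcal{B}(\mathcal{A}_f)$, there exists a sequence $(t_k)_{k\in\mathbb{N}}$, depending on $P$ and $G$, such that $$\lim_{i\to+\infty}\frac{1}{t_{2i}}\int_0^{t_{2i}}G(\varphi(t,P))\,dt=\frac{1}{1+\gamma_1}\,G(\sigma_1)+\frac{\gamma_1}{1+\gamma_1}\,G(\sigma_2)$$ and $$\lim_{i\to+\infty}\frac{1}{t_{2i+1}}\int_0^{t_{2i+1}}G(\varphi(t,P))\,dt=\frac{\gamma_2}{1+\gamma_2}\,G(\sigma_1)+\frac{1}{1+\gamma_2}\,G(\sigma_2).$$ Consequently, every point in $\mathcal{B}(\mathcal{A}_f)$ has historic behavior.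
   Context: **The class of vector fields.** Let $\mathbf{S}^3=\{x\in\mathbb{R}^4: x_1^2+x_2^2+x_3^2+x_4^2=1\}$. $\mathfrak{X}^r_{\mathrm{Byk}}(\mathbf{S}^3)$, $r\ge3$, is the set of $C^r$ vector fields $f$ on $\mathbf{S}^3$ with flow $\varphi(t,x)$ such that: (P1) $f\circ\Gamma_1=\Gamma_1\circ f$ and $f\circ\Gamma_2=\Gamma_2\circ f$, where $\Gamma_1(x_1,x_2,x_3,x_4)=(-x_1,-x_2,x_3,x_4)$ and $\Gamma_2(x_1,x_2,x_3,x_4)=(x_1,x_2,-x_3,x_4)$. (P2) The common fixed set of $\Gamma_1,\Gamma_2$ in $\mathbf{S}^3$ consists of two equilibria $\sigma_1=(0,0,0,1)$, $\sigma_2=(0,0,0,-1)$, hyperbolic saddle-foci with eigenvalues $-C_1\pm\omega_1 i,\ E_1$ at $\sigma_1$ and $E_2\pm\omega_2 i,\ -C_2$ at $\sigma_2$, where $\omega_1,\omega_2>0$, $C_1>E_1>0$, $C_2>E_2>0$. (P3) The invariant circle $\mathrm{Fix}(\Gamma_1)=\{Q\in\mathbf{S}^3:\Gamma_1(Q)=Q\}$ consists of $\sigma_1,\sigma_2$ and two heteroclinic trajectories from $\sigma_1$ to $\sigma_2$. (P4) The invariant sphere $\mathrm{Fix}(\Gamma_2)$ consists of $\sigma_1,\sigma_2$ and a two-dimensional heteroclinic connection from $\sigma_2$ to $\sigma_1$. (P5) $\sigma_1,\sigma_2$ have the same chirality: near $\sigma_1$ and $\sigma_2$ all trajectories turn in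 the same direction around the one-dimensional connections. $\mathcal{A}_f$ is the heteroclinic network formed by $\sigma_1,\sigma_2$, the two trajectories of (P3) and the two-dimensional connection of (P4); it is asymptotically stable. Its proper basin is $\mathcal{B}(\mathcal{A}_f)=\{P\in\mathbf{S}^3:$ all accumulation points of $\varphi(t,P)$, as $t\to+\infty$, belong to $\mathcal{A}_f\}\setminus\mathcal{A}_f$. **Constants.** $\gamma_1=C_1/E_2$, $\gamma_2=C_2/E_1$, $\delta_1=C_1/E_1$, $\delta_2=C_2/E_2$. **Standing assumptions near the network.** One uses linearizing cylindrical coordinates $(\rho,\theta,z)$ in cylinders $V_{\sigma_1},V_{\sigma_2}$ (radius 1, height 2) around $\sigma_1,\sigma_2$; by the symmetry $\Gamma_2$ it suffices to treat $z>0$. Let $\mathrm{In}^+(\sigma_1)=\{(1,\theta,z):0<z<1\}$, $\mathrm{Out}^+(\sigma_1)=\{(\rho,\theta,1):0\le\rho<1\}$ in $V_{\sigma_1}$, and $\mathrm{In}^+(\sigma_2)=\{(\rho,\theta,1):0\le\rho<1\}$, $\mathrm{Out}^+(\sigma_2)=\{(1,\theta,z):0<z<1\}$ in $V_{\sigma_2}$. A point $(1,\theta,z)\in\mathrm{In}^+(\sigma_1)$ spends time $-\frac1{E_1}\log z$ in $V_{\sigma_1}$ and leaves at $\Phi_1^+(1,\theta,z)=\big(z^{\delta_1}+\mathcal{S}_1,\ [-\tfrac{\omega_1}{E_1}\log z+\theta+\mathcal{S}_2]\bmod 2\pi,\ 1\big)\in\mathrm{Out}^+(\sigma_1)$; a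 point $(\rho,\theta,1)\in\mathrm{In}^+(\sigma_2)$ with $\rho>0$ spends time $-\frac1{E_2}\log\rho$ in $V_{\sigma_2}$ and leaves at $\Phi_2^+(\rho,\theta,1)=\big(1,\ [-\tfrac{\omega_2}{E_2}\log\rho+\theta+\mathcal{T}_1]\bmod 2\pi,\ \rho^{\delta_2}+\mathcal{T}_2\big)\in\mathrm{Out}^+(\sigma_2)$. Here $\mathcal{S}_i=\mathcal{S}_i(1,\theta,z)$, $\mathcal{T}_i=\mathcal{T}_i(\rho,\theta,1)$ are smooth and, for some $0<\varepsilon<1$, all their partial derivatives of all orders $\ge0$ are $\mathcal{O}(z^{\delta_1(1+\varepsilon)})$, respectively $\mathcal{O}(\rho^{\delta_2(1+\varepsilon)})$. The transition map $\Psi^+_{1\to2}:\mathrm{Out}^+(\sigma_1)\to\mathrm{In}^+(\sigma_2)$ is the identity, and $\Psi^+_{2\to1}:\mathrm{Out}^+(\sigma_2)\to\mathrm{In}^+(\sigma_1)$ is $(1,\theta,z)\mapsto(1,\frac1a\theta,az)$ for some $0<a<1$. Both transitions are assumed to be instantaneous (they take zero time). **Historic behavior.** A point $P$ has historic behavior if for some continuous $G:\mathbf{S}^3\to\mathbb{R}$ the averages $\frac1t\int_0^tG(\varphi(s,P))\,ds$ do not converge as $t\to+\infty$. *)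

theory Defs
  imports "HOL-Analysis.Analysis" "HOL-Library.Landau_Symbols"
begin

section \<open>Smoothness\<close>

text \<open>Meant for open sets \<open>U\<close>: derivatives are two-sided, and \<open>f\<close> may be arbitrary outside \<open>U\<close>.\<close>

fun Ck_on :: "nat \<Rightarrow> ('a::euclidean_space \<Rightarrow> 'b::real_normed_vector) \<Rightarrow> 'a set \<Rightarrow> bool" where
  "Ck_on 0 f U \<longleftrightarrow> continuous_on U f"
| "Ck_on (Suc k) f U \<longleftrightarrow>
     (\<forall>x\<in>U. f differentiable (at x)) \<and>
     (\<forall>v. Ck_on k (\<lambda>x. frechet_derivative f (at x) v) U)"

fun iterated_partial :: "'a list \<Rightarrow> ('a::euclidean_space \<Rightarrow> real) \<Rightarrow> 'a \<Rightarrow> real" where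
  "iterated_partial [] f = f"
| "iterated_partial (b # bs) f = iterated_partial bs (\<lambda>x. frechet_derivative f (at x) b)"


section \<open>Vector fields on the 3-sphere\<close>

abbreviation S3 :: "(real^4) set" where
  "S3 \<equiv> sphere 0 1"

text \<open>
  A vector field on the sphere is a map into \<open>real^4\<close>, only its values on \<^term>\<open>S3\<close> matter.
  It is of class \<open>C^r\<close> on the submanifold \<^term>\<open>S3\<close> iff its radial extension, constant on open rays
  from the origin, is of class \<open>C^r\<close> off the origin.
\<close>

definition radial_ext :: "(real^4 \<Rightarrow> real^4) \<Rightarrow> real^4 \<Rightarrow> real^4" where
  "radial_ext f x = f (x /\<^sub>R norm x)"

definition Cr_vector_field :: "nat \<Rightarrow> (real^4 \<Rightarrow> real^4) \<Rightarrow> bool" where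
  "Cr_vector_field r f \<longleftrightarrow> (\<forall>x\<in>S3. f x \<bullet> x = 0) \<and> Ck_on r (radial_ext f) (- {0})"

definition is_flow :: "(real^4 \<Rightarrow> real^4) \<Rightarrow> (real \<Rightarrow> real^4 \<Rightarrow> real^4) \<Rightarrow> bool" where
  "is_flow f \<phi> \<longleftrightarrow>
     (\<forall>x\<in>S3. \<phi> 0 x = x \<and>
        (\<forall>t. \<phi> t x \<in> S3 \<and> ((\<lambda>s. \<phi> s x) has_vector_derivative f (\<phi> t x)) (at t)))"

text \<open>
  On the tangent space \<open>{v. v \<bullet> s = 0}\<close> the derivative of the radial extension at an equilibrium \<open>s\<close>
  is the linearization of the vector field, an endomorphism of the tangent space.
\<close>

definition linearization :: "(real^4 \<Rightarrow> real^4) \<Rightarrow> real^4 \<Rightarrow> real^4 \<Rightarrow> real^4" where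
  "linearization f s = frechet_derivative (radial_ext f) (at s)"

text \<open>
  The complex eigenvalues of the linearization on the complexified tangent space; \<open>u\<close> and \<open>v\<close> are the
  real and imaginary parts of an eigenvector. The tangent space is 3-dimensional, so three
  distinct eigenvalues are automatically simple.
\<close>

definition tangent_eigenvalues :: "(real^4 \<Rightarrow> real^4) \<Rightarrow> real^4 \<Rightarrow> complex set" where
  "tangent_eigenvalues f s =
     {l. \<exists>u v. u \<bullet> s = 0 \<and> v \<bullet> s = 0 \<and> (u \<noteq> 0 \<or> v \<noteq> 0) \<and>
           linearization f s u = Re l *\<^sub>R u - Im l *\<^sub>R v \<and>
           linearization f s v = Im l *\<^sub>R u + Re l *\<^sub>R v}"


section \<open>Bykov vector fields\<close>

definition Gamma1 :: "real^4 \<Rightarrow> real^4" where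
  "Gamma1 x = vector [- x$1, - x$2, x$3, x$4]"

definition Gamma2 :: "real^4 \<Rightarrow> real^4" where
  "Gamma2 x = vector [x$1, x$2, - x$3, x$4]"

definition sigma1 :: "real^4" where
  "sigma1 = vector [0, 0, 0, 1]"

definition sigma2 :: "real^4" where
  "sigma2 = vector [0, 0, 0, -1]"

definition Fix :: "(real^4 \<Rightarrow> real^4) \<Rightarrow> (real^4) set" where
  "Fix g = {x \<in> S3. g x = x}"

definition orbit :: "(real \<Rightarrow> real^4 \<Rightarrow> real^4) \<Rightarrow> real^4 \<Rightarrow> (real^4) set" where
  "orbit \<phi> x = range (\<lambda>t. \<phi> t x)"

definition heteroclinic ::
  "(real \<Rightarrow> real^4 \<Rightarrow> real^4) \<Rightarrow> real^4 \<Rightarrow> real^4 \<Rightarrow> (real^4) set" where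
  "heteroclinic \<phi> a b =
     {x \<in> S3. ((\<lambda>t. \<phi> t x) \<longlongrightarrow> a) at_bot \<and> ((\<lambda>t. \<phi> t x) \<longlongrightarrow> b) at_top}"

text \<open>
  The one-dimensional connections lie on the circle \<^term>\<open>Fix Gamma1\<close>, that is \<open>x$1 = x$2 = 0\<close>. A trajectory
  off this circle turns around it with the angle of \<open>(x$1, x$2)\<close>; the following is the time
  derivative of that angle along the trajectory through \<open>x\<close>.
\<close>

definition turning_speed :: "(real^4 \<Rightarrow> real^4) \<Rightarrow> real^4 \<Rightarrow> real" where
  "turning_speed f x = (x$1 * f x $ 2 - x$2 * f x $ 1) / ((x$1)\<^sup>2 + (x$2)\<^sup>2)"

locale bykov_field =
  fixes r :: nat
    and f :: "real^4 \<Rightarrow> real^4"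
    and \<phi> :: "real \<Rightarrow> real^4 \<Rightarrow> real^4"
    and C1 \<omega>1 E1 C2 \<omega>2 E2 :: real
  assumes r_ge: "r \<ge> 3"
    and field: "Cr_vector_field r f"
    and flow: "is_flow f \<phi>"
    and P1: "\<forall>x\<in>S3. f (Gamma1 x) = Gamma1 (f x)" "\<forall>x\<in>S3. f (Gamma2 x) = Gamma2 (f x)"
    and P2_equilibria: "Fix Gamma1 \<inter> Fix Gamma2 = {sigma1, sigma2}" "f sigma1 = 0" "f sigma2 = 0"
    and P2_constants: "\<omega>1 > 0" "\<omega>2 > 0" "C1 > E1" "E1 > 0" "C2 > E2" "E2 > 0"
    and P2_eigenvalues:
      "tangent_eigenvalues f sigma1 = {Complex (- C1) \<omega>1, Complex (- C1) (- \<omega>1), complex_of_real E1}"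
      "tangent_eigenvalues f sigma2 = {Complex E2 \<omega>2, Complex E2 (- \<omega>2), complex_of_real (- C2)}"
    and P3: "\<exists>Q1 Q2. Q1 \<in> heteroclinic \<phi> sigma1 sigma2 \<and> Q2 \<in> heteroclinic \<phi> sigma1 sigma2 \<and>
               orbit \<phi> Q1 \<inter> orbit \<phi> Q2 = {} \<and>
               Fix Gamma1 = {sigma1, sigma2} \<union> orbit \<phi> Q1 \<union> orbit \<phi> Q2"
    and P4: "Fix Gamma2 - {sigma1, sigma2} \<subseteq> heteroclinic \<phi> sigma2 sigma1"
    and P5: "\<exists>s\<in>{-1, 1}. \<exists>U. open U \<and> sigma1 \<in> U \<and> sigma2 \<in> U \<and>
               (\<forall>x\<in>U \<inter> S3 - Fix Gamma1. s * turning_speed f x > 0)"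


section \<open>The network, its proper basin, and historic behavior\<close>

definition network :: "(real \<Rightarrow> real^4 \<Rightarrow> real^4) \<Rightarrow> (real^4) set" where
  "network \<phi> = {sigma1, sigma2}
     \<union> (Fix Gamma1 \<inter> heteroclinic \<phi> sigma1 sigma2)
     \<union> (Fix Gamma2 \<inter> heteroclinic \<phi> sigma2 sigma1)"

definition omega_limit :: "(real \<Rightarrow> real^4 \<Rightarrow> real^4) \<Rightarrow> real^4 \<Rightarrow> (real^4) set" where
  "omega_limit \<phi> x =
     {y. \<exists>s. filterlim s at_top sequentially \<and> (\<lambda>n. \<phi> (s n) x) \<longlonglongrightarrow> y}"

definition proper_basin :: "(real \<Rightarrow> real^4 \<Rightarrow> real^4) \<Rightarrow> (real^4) set" where
  "proper_basin \<phi> = {x \<in> S3. omega_limit \<phi> x \<subseteq> network \<phi>} - network \<phi>"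

definition time_average ::
  "(real \<Rightarrow> real^4 \<Rightarrow> real^4) \<Rightarrow> (real^4 \<Rightarrow> real) \<Rightarrow> real^4 \<Rightarrow> real \<Rightarrow> real" where
  "time_average \<phi> G x t = (1 / t) * integral {0..t} (\<lambda>s. G (\<phi> s x))"

definition historic :: "(real \<Rightarrow> real^4 \<Rightarrow> real^4) \<Rightarrow> real^4 \<Rightarrow> bool" where
  "historic \<phi> x \<longleftrightarrow>
     (\<exists>G. continuous_on S3 G \<and> \<not> (\<exists>L. (time_average \<phi> G x \<longlongrightarrow> L) at_top))"


section \<open>Cylindrical coordinates near the equilibria\<close>

text \<open>
  The point with cylindrical coordinates \<open>(\<rho>, \<theta>, z)\<close> is \<open>\<psi> (rcis \<rho> \<theta>, z)\<close>, so that angles are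
  automatically taken modulo \<open>2 * pi\<close>.
\<close>

definition cyl :: "(complex \<times> real) set" where
  "cyl = cball 0 1 \<times> {-1..1}"

definition open_cyl :: "(complex \<times> real) set" where
  "open_cyl = ball 0 1 \<times> {-1<..<1}"

definition cyl_rim :: "(complex \<times> real) set" where
  "cyl_rim = sphere 0 1 \<times> {-1, 1}"

text \<open>
  Coordinates \<open>\<psi>\<close> on a cylinder around the equilibrium \<open>s\<close>, compatible with the symmetries, in which
  the linear part of the field is \<open>(w, z) \<mapsto> (l * w, m * z)\<close>. The flow inside the cylinder need not be
  linear beyond first order: the remainders in the passage maps below are allowed to be
  nonzero.

  Injectivity is not required on the two rim circles. The top disc of either
  cylinder is glued to the top disc of the other, and the wall of the second one to the part
  \<open>\<bar>z\<bar> < a\<close> of the wall of the first one, with \<open>a < 1\<close>. By continuity the points of the first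
  cylinder with \<open>\<rho> = 1\<close>, \<open>z = 1\<close> then coincide with points with \<open>\<rho> = 1\<close>, \<open>z = a\<close>.
\<close>

definition cylinder_chart ::
  "(real^4 \<Rightarrow> real^4) \<Rightarrow> real^4 \<Rightarrow> complex \<Rightarrow> real \<Rightarrow> (complex \<times> real \<Rightarrow> real^4) \<Rightarrow> bool" where
  "cylinder_chart f s l m \<psi> \<longleftrightarrow>
     \<psi> (0, 0) = s \<and> continuous_on cyl \<psi> \<and> \<psi> ` cyl \<subseteq> S3 \<and> inj_on \<psi> (cyl - cyl_rim) \<and>
     openin (top_of_set S3) (\<psi> ` open_cyl) \<and>
     Ck_on 1 \<psi> open_cyl \<and> (\<forall>q\<in>open_cyl. inj (frechet_derivative \<psi> (at q))) \<and>
     (\<forall>w z. frechet_derivative \<psi> (at (0, 0)) (l * w, m * z) =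
              linearization f s (frechet_derivative \<psi> (at (0, 0)) (w, z))) \<and>
     (\<forall>(w, z)\<in>cyl. Gamma2 (\<psi> (w, z)) = \<psi> (w, - z) \<and>
        (\<psi> (w, z) \<in> Fix Gamma1 \<longleftrightarrow> w = 0) \<and> (\<psi> (w, z) \<in> Fix Gamma2 \<longleftrightarrow> z = 0))"

text \<open>The trajectory enters \<open>V\<close> at \<open>p\<close>, spends time \<open>\<tau>\<close> in \<open>V\<close>, and leaves it at \<open>q\<close>.\<close>

definition passage ::
  "(real \<Rightarrow> real^4 \<Rightarrow> real^4) \<Rightarrow> (real^4) set \<Rightarrow> real^4 \<Rightarrow> real \<Rightarrow> real^4 \<Rightarrow> bool" where
  "passage \<phi> V p \<tau> q \<longleftrightarrow>
     (\<forall>t\<in>{0..\<tau>}. \<phi> t p \<in> V) \<and> \<phi> \<tau> p = q \<and>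
     (\<forall>\<^sub>F t in at_left 0. \<phi> t p \<notin> V) \<and> (\<forall>\<^sub>F t in at_right \<tau>. \<phi> t p \<notin> V)"

text \<open>
  A remainder is a function of \<open>(\<theta>, y)\<close> with \<open>\<theta>\<close> an angle and \<open>0 < y < 1\<close>. The estimates are for \<open>y \<rightarrow> 0\<close>,
  uniformly in \<open>\<theta>\<close>, with a constant depending on the partial derivative.
\<close>

definition small_remainder :: "real \<Rightarrow> (real \<times> real \<Rightarrow> real) \<Rightarrow> bool" where
  "small_remainder p R \<longleftrightarrow>
     (\<forall>\<theta> y. R (\<theta> + 2 * pi, y) = R (\<theta>, y)) \<and>
     (\<forall>k. Ck_on k R (UNIV \<times> {0<..<1})) \<and>
     (\<forall>bs. set bs \<subseteq> Basis \<longrightarrow>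
        iterated_partial bs R \<in> O[top \<times>\<^sub>F at_right 0](\<lambda>(\<theta>, y). y powr p))"

text \<open>
  The transitions take zero time, so they are equalities between points of the sphere written in the
  two coordinate systems. In the transition from \<open>sigma2\<close> to \<open>sigma1\<close> the angle is often taken to be
  \<open>h \<theta> = \<theta> / a\<close>. For \<open>0 < a < 1\<close> and angles modulo \<open>2 * pi\<close> that map is not injective on the circle, which
  an actual flow cannot realize; \<open>h\<close> is therefore left arbitrary, which includes this choice.
\<close>

locale bykov_coordinates = bykov_field r f \<phi> C1 \<omega>1 E1 C2 \<omega>2 E2
  for r :: nat
    and f :: "real^4 \<Rightarrow> real^4"
    and \<phi> :: "real \<Rightarrow> real^4 \<Rightarrow> real^4"
    and C1 \<omega>1 E1 C2 \<omega>2 E2 :: real +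
  fixes \<psi>1 \<psi>2 :: "complex \<times> real \<Rightarrow> real^4"
    and S1 S2 T1 T2 :: "real \<times> real \<Rightarrow> real"
    and \<epsilon> a :: real
    and h :: "real \<Rightarrow> real"
  assumes chart1: "cylinder_chart f sigma1 (Complex (- C1) \<omega>1) E1 \<psi>1"
    and chart2: "cylinder_chart f sigma2 (Complex E2 \<omega>2) (- C2) \<psi>2"
    and disjoint: "\<psi>1 ` open_cyl \<inter> \<psi>2 ` cyl = {}" "\<psi>1 ` cyl \<inter> \<psi>2 ` open_cyl = {}"
    and eps: "0 < \<epsilon>" "\<epsilon> < 1"
    and remainders:
      "small_remainder (C1 / E1 * (1 + \<epsilon>)) S1" "small_remainder (C1 / E1 * (1 + \<epsilon>)) S2"
      "small_remainder (C2 / E2 * (1 + \<epsilon>)) T1" "small_remainder (C2 / E2 * (1 + \<epsilon>)) T2"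
    and passage1: "\<forall>\<theta>. \<forall>z\<in>{0<..<1}.
      0 \<le> z powr (C1 / E1) + S1 (\<theta>, z) \<and> z powr (C1 / E1) + S1 (\<theta>, z) < 1 \<and>
      passage \<phi> (\<psi>1 ` cyl) (\<psi>1 (rcis 1 \<theta>, z)) (- (1 / E1) * ln z)
        (\<psi>1 (rcis (z powr (C1 / E1) + S1 (\<theta>, z)) (- (\<omega>1 / E1) * ln z + \<theta> + S2 (\<theta>, z)), 1))"
    and passage2: "\<forall>\<theta>. \<forall>\<rho>\<in>{0<..<1}.
      0 < \<rho> powr (C2 / E2) + T2 (\<theta>, \<rho>) \<and> \<rho> powr (C2 / E2) + T2 (\<theta>, \<rho>) < 1 \<and>
      passage \<phi> (\<psi>2 ` cyl) (\<psi>2 (rcis \<rho> \<theta>, 1)) (- (1 / E2) * ln \<rho>)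
        (\<psi>2 (rcis 1 (- (\<omega>2 / E2) * ln \<rho> + \<theta> + T1 (\<theta>, \<rho>)), \<rho> powr (C2 / E2) + T2 (\<theta>, \<rho>)))"
    and transition12: "\<forall>\<theta>. \<forall>\<rho>\<in>{0..<1}. \<psi>1 (rcis \<rho> \<theta>, 1) = \<psi>2 (rcis \<rho> \<theta>, 1)"
    and a_range: "0 < a" "a < 1"
    and transition21: "\<forall>\<theta>. \<forall>z\<in>{0<..<1}. \<psi>2 (rcis 1 \<theta>, z) = \<psi>1 (rcis 1 (h \<theta>), a * z)"

end

theory Submission
  imports Defs
begin

text \<open>
  A trajectory in the basin accumulates on the network without lying on it, so it alternates between
  ever longer sojourns in the two cylinders. Two facts determine its time averages.

  The first is that such a trajectory is, on average, close to the equilibria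
  (\<open>eq_dist_average_tendsto_0\<close>). Every point of the network is forward asymptotic to an equilibrium,
  hence the distance to the equilibria has small averages over suitable times, and by compactness
  over times of bounded length and for all points near the network. Therefore the average of \<open>G\<close>
  over \<open>[0, t]\<close> differs by \<open>o(1)\<close> from a convex combination of \<open>G sigma1\<close> and \<open>G sigma2\<close>, in which the
  weights are the proportions of time spent in the two cylinders.

  The second concerns these proportions (\<open>itinerary\<close>). A trajectory that enters the first cylinder
  at height \<open>z\<close> stays there for the time \<open>- ln z / E1\<close> and leaves at a radius \<open>\<rho>\<close> comparable to
  \<open>z powr (C1 / E1)\<close>; it then stays in the second cylinder for the time \<open>- ln \<rho> / E2\<close>. The entry
  heights tend to \<open>0\<close>, because accumulation points of the entry points belong to the network, so the
  quotient of the second time by the first tends to \<open>\<gamma>1 = C1 / E2\<close>. In the same way, the quotient of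
  the next time near \<open>sigma1\<close> by the last one near \<open>sigma2\<close> tends to \<open>\<gamma>2 = C2 / E1\<close>. By the
  Stolz-Cesaro theorem the accumulated times have the same limit quotients. At the ends of the
  sojourns near \<open>sigma2\<close> the weights thus tend to \<open>1 / (1 + \<gamma>1)\<close> and \<open>\<gamma>1 / (1 + \<gamma>1)\<close>, and at the ends
  of the sojourns near \<open>sigma1\<close> to \<open>\<gamma>2 / (1 + \<gamma>2)\<close> and \<open>1 / (1 + \<gamma>2)\<close>. The two limits differ as soon as
  \<open>G sigma1 \<noteq> G sigma2\<close>, since \<open>\<gamma>1 * \<gamma>2 > 1\<close>; this is the historic behavior.

  It has to be shown that each basin trajectory begins such an itinerary (\<open>reaches_In_sigma1\<close>). Being
  close to the equilibria on average, it visits one of the cylinders. If it never left that cylinder it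
  would converge to the equilibrium inside; but near an equilibrium the field expands the directions
  that are reversed by one of the two symmetries, so that only points fixed by this symmetry, which
  lie on the network, can converge there (\<open>convergent_off_expanding_directions\<close>). The trajectory
  therefore crosses the boundary of the cylinder, where the known passage maps take over.
\<close>

section \<open>Lipschitz estimates and separation of solutions\<close>

lemma Ck_on_imp_continuous_on:
  assumes "Ck_on k g U"
  shows "continuous_on U g"
proof (cases k)
  case 0
  then show ?thesis using assms by simp
next
  case (Suc n)
  then show ?thesis using assms
    by (simp add: continuous_at_imp_continuous_on differentiable_imp_continuous_within)
qed

lemma linear_norm_le_sum_Basis:
  fixes T :: "'a::euclidean_space \<Rightarrow> 'b::real_normed_vector"
  assumes "linear T"
  shows "norm (T v) \<le> (\<Sum>b\<in>Basis. norm (T b)) * norm v"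
proof -
  interpret linear T by fact
  have "T v = (\<Sum>b\<in>Basis. (v \<bullet> b) *\<^sub>R T b)"
    by (subst euclidean_representation[of v, symmetric]) (simp only: sum scale)
  also have "norm \<dots> \<le> (\<Sum>b\<in>Basis. norm (T b) * norm v)"
    by (rule sum_norm_le) (metis norm_scaleR Basis_le_norm mult.commute mult_left_mono norm_ge_zero)
  finally show ?thesis by (simp add: sum_distrib_right)
qed

text \<open>
  A linear map is bounded by its values on a basis, so continuity of the directional derivatives
  gives continuity of the derivative in operator norm.
\<close>

lemma C1_derivative_close:
  fixes F :: "'a::euclidean_space \<Rightarrow> 'b::real_normed_vector"
  assumes "open U" "Ck_on (Suc k) F U" "x \<in> U" "e > 0"
  obtains d where "d > 0" "ball x d \<subseteq> U"
    "\<And>y v. y \<in> ball x d \<Longrightarrow>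
       norm (frechet_derivative F (at y) v - frechet_derivative F (at x) v) \<le> e * norm v"
proof -
  let ?D = "\<lambda>y. frechet_derivative F (at y)"
  let ?S = "\<lambda>y. \<Sum>b\<in>Basis. norm (?D y b - ?D x b)"
  have "continuous_on U ?S"
    using assms(2) by (intro continuous_intros) (auto intro: Ck_on_imp_continuous_on)
  then have "isCont ?S x"
    using assms(1,3) continuous_on_eq_continuous_at by blast
  then have "\<forall>\<^sub>F y in at x. ?S y < e"
    using assms(4) by (intro order_tendstoD(2)[of ?S "?S x"]) (auto simp: isCont_def)
  moreover have "\<forall>\<^sub>F y in at x. y \<in> U"
    using assms(1,3) by (simp add: eventually_at_in_open')
  ultimately have "\<forall>\<^sub>F y in at x. ?S y < e \<and> y \<in> U"
    by eventually_elim simp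
  then obtain d where d: "d > 0" "\<And>y. y \<noteq> x \<Longrightarrow> dist y x < d \<Longrightarrow> ?S y < e \<and> y \<in> U"
    unfolding eventually_at by auto
  have *: "?S y < e \<and> y \<in> U" if "y \<in> ball x d" for y
    using d(2)[of y] that assms(3,4) by (cases "y = x") (auto simp: dist_commute)
  show thesis
  proof
    fix y v assume y: "y \<in> ball x d"
    have "linear (\<lambda>v. ?D y v - ?D x v)"
      using assms(2,3) * [OF y] by (intro linear_compose_sub linear_frechet_derivative) auto
    from linear_norm_le_sum_Basis[OF this, of v]
    show "norm (?D y v - ?D x v) \<le> e * norm v"
      using *[OF y] mult_right_mono[of "?S y" e "norm v"] by auto
  qed (use d * in auto)
qed

text \<open>
  Nearby points of the sphere are joined by a segment in a compact annulus around the origin, where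
  the derivative of the radial extension is bounded. For distant points it suffices that the field is
  bounded.
\<close>

lemma Lipschitz_of_C1_radial_ext:
  assumes C1: "Ck_on (Suc k) (radial_ext f) (- {0})"
  shows "\<exists>L\<ge>0. \<forall>x\<in>S3. \<forall>y\<in>S3. norm (f x - f y) \<le> L * norm (x - y)"
proof -
  let ?F = "radial_ext f"
  let ?D = "\<lambda>y. frechet_derivative ?F (at y)"
  let ?S = "\<lambda>y. \<Sum>b\<in>Basis. norm (?D y b)"
  let ?A = "cball 0 2 - ball 0 (1/2) :: (real^4) set"
  have Ff: "?F x = f x" if "x \<in> S3" for x
    using that by (simp add: radial_ext_def)
  have "compact ?A" by (intro compact_diff) auto
  moreover have "continuous_on ?A ?S"
    using C1 by (intro continuous_intros continuous_on_subset[OF Ck_on_imp_continuous_on, of k]) auto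
  ultimately have "bounded (?S ` ?A)"
    by (intro compact_imp_bounded compact_continuous_image)
  then obtain B where B: "\<And>y. y \<in> ?A \<Longrightarrow> norm (?S y) \<le> B"
    unfolding bounded_iff by blast
  have "continuous_on S3 ?F"
    by (rule continuous_on_subset[OF Ck_on_imp_continuous_on[OF C1]]) auto
  then have "bounded (?F ` S3)"
    by (intro compact_imp_bounded compact_continuous_image) auto
  then obtain M where M: "\<And>x. x \<in> S3 \<Longrightarrow> norm (f x) \<le> M"
    unfolding bounded_iff using Ff by (metis imageI)
  define L where "L = max 0 (max B (4 * M))"
  have "norm (f x - f y) \<le> L * norm (x - y)" if xy: "x \<in> S3" "y \<in> S3" for x y
  proof (cases "norm (x - y) \<le> 1/2")
    case True
    have seg: "z \<in> ?A" if "z \<in> closed_segment x y" for z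
    proof -
      have "norm (z - x) \<le> 1/2"
        using segment_bound(1)[OF that] True by (simp add: norm_minus_commute)
      then have "norm x - norm z \<le> 1/2" "norm z - norm x \<le> 1/2"
        using norm_triangle_ineq2[of x z] norm_triangle_ineq2[of z x]
        by (auto simp: norm_minus_commute)
      then show ?thesis using xy by auto
    qed
    have "norm (?F x - ?F y) \<le> B * norm (x - y)"
    proof (rule differentiable_bound[where S = "closed_segment x y" and f' = ?D])
      fix z assume z: "z \<in> closed_segment x y"
      then have zA: "z \<in> ?A" by (rule seg)
      then have "z \<noteq> 0" by auto
      then have df: "?F differentiable (at z)" using C1 by auto
      then show "(?F has_derivative ?D z) (at z within closed_segment x y)"
        using frechet_derivative_works has_derivative_at_withinI by blast
      have "norm (?D z v) \<le> B * norm v" for v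
        using linear_norm_le_sum_Basis[OF linear_frechet_derivative[OF df], of v] B[OF zA]
          mult_right_mono[of "?S z" B "norm v"] by (auto simp: sum_nonneg)
      then show "onorm (?D z) \<le> B" by (rule onorm_le)
    qed auto
    also have "\<dots> \<le> L * norm (x - y)" by (intro mult_right_mono) (auto simp: L_def)
    finally show ?thesis using Ff xy by simp
  next
    case False
    have "norm (f x - f y) \<le> 2 * M"
      using norm_triangle_ineq4[of "f x" "f y"] M[OF xy(1)] M[OF xy(2)] by linarith
    also have "\<dots> \<le> 4 * M * norm (x - y)"
      using False order_trans[OF norm_ge_zero M[OF xy(1)]]
        mult_left_mono[of "1/2" "norm (x - y)" "4 * M"] by simp
    also have "\<dots> \<le> L * norm (x - y)" by (intro mult_right_mono) (auto simp: L_def)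
    finally show ?thesis .
  qed
  moreover have "L \<ge> 0" by (simp add: L_def)
  ultimately show ?thesis by blast
qed

lemma has_real_derivative_inner_self:
  fixes Z :: "real \<Rightarrow> 'a::real_inner"
  assumes "(Z has_vector_derivative z) (at s)"
  shows "((\<lambda>t. Z t \<bullet> Z t) has_real_derivative 2 * (Z s \<bullet> z)) (at s)"
proof -
  have d: "(Z has_derivative (\<lambda>h. h *\<^sub>R z)) (at s)"
    using assms by (simp add: has_vector_derivative_def)
  have "((\<lambda>t. Z t \<bullet> Z t) has_derivative (\<lambda>h. h * (2 * (Z s \<bullet> z)))) (at s)"
    by (rule has_derivative_eq_rhs[OF has_derivative_inner[OF d d]])
      (auto simp: inner_commute)
  then show ?thesis
    by (simp add: has_field_derivative_def mult_commute_abs)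
qed

text \<open>
  Gronwall's argument: the weight \<open>exp (- 2 * L * t)\<close> makes the squared distance nonincreasing.
\<close>

lemma solutions_separate_at_most_exponentially_forward:
  fixes X Y :: "real \<Rightarrow> 'a::real_inner"
  assumes Lip: "\<And>x y. x \<in> S \<Longrightarrow> y \<in> S \<Longrightarrow> norm (g x - g y) \<le> L * norm (x - y)"
    and X: "\<And>t. X t \<in> S" "\<And>t. (X has_vector_derivative g (X t)) (at t)"
    and Y: "\<And>t. Y t \<in> S" "\<And>t. (Y has_vector_derivative g (Y t)) (at t)"
    and "t \<ge> 0"
  shows "norm (X t - Y t) \<le> exp (L * t) * norm (X 0 - Y 0)"
proof -
  let ?d = "\<lambda>t. X t - Y t"
  let ?u = "\<lambda>t. exp (- 2 * L * t) * (?d t \<bullet> ?d t)"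
  have "\<exists>y. (?u has_real_derivative y) (at s) \<and> y \<le> 0" for s
  proof -
    let ?e = "g (X s) - g (Y s)"
    have "((\<lambda>t. ?d t \<bullet> ?d t) has_real_derivative (2 * (?d s \<bullet> ?e))) (at s)"
      by (intro has_real_derivative_inner_self has_vector_derivative_diff X Y)
    from DERIV_mult[OF _ this, of "\<lambda>t. exp (- 2 * L * t)" "- 2 * L * exp (- 2 * L * s)"]
    have "(?u has_real_derivative - 2 * L * exp (- 2 * L * s) * (?d s \<bullet> ?d s)
        + 2 * (?d s \<bullet> ?e) * exp (- 2 * L * s)) (at s)"
      by (rule meta_mp) (auto intro!: derivative_eq_intros)
    moreover have "- 2 * L * exp (- 2 * L * s) * (?d s \<bullet> ?d s) + 2 * (?d s \<bullet> ?e) * exp (- 2 * L * s)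
        = exp (- 2 * L * s) * (2 * (?d s \<bullet> ?e) - 2 * L * (?d s \<bullet> ?d s))"
      by (simp only: ring_distribs mult_ac)
    ultimately have "(?u has_real_derivative
        exp (- 2 * L * s) * (2 * (?d s \<bullet> ?e) - 2 * L * (?d s \<bullet> ?d s))) (at s)"
      by (simp only:)
    moreover have "?d s \<bullet> ?e \<le> L * (?d s \<bullet> ?d s)"
    proof -
      have "?d s \<bullet> ?e \<le> norm (?d s) * norm ?e" by (rule norm_cauchy_schwarz)
      also have "\<dots> \<le> norm (?d s) * (L * norm (?d s))"
        using Lip[OF X(1) Y(1)] by (intro mult_left_mono) auto
      finally show ?thesis by (simp add: dot_square_norm power2_eq_square algebra_simps)
    qed
    ultimately show ?thesis
      by (intro exI[of _ "exp (- 2 * L * s) * (2 * (?d s \<bullet> ?e) - 2 * L * (?d s \<bullet> ?d s))"] conjI)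
         (auto simp: mult_le_0_iff)
  qed
  then have "?u t \<le> ?u 0"
    using \<open>t \<ge> 0\<close> by (intro DERIV_nonpos_imp_nonincreasing[of 0 t ?u]) auto
  then have "exp (2 * L * t) * ?u t \<le> exp (2 * L * t) * (norm (?d 0))\<^sup>2"
    by (intro mult_left_mono) (auto simp: dot_square_norm)
  moreover have "exp (2 * L * t) * ?u t = (norm (?d t))\<^sup>2"
    by (simp add: dot_square_norm mult.assoc[symmetric] exp_add[symmetric])
  ultimately have "(norm (?d t))\<^sup>2 \<le> exp (2 * L * t) * (norm (?d 0))\<^sup>2"
    by (simp only:)
  then have "(norm (?d t))\<^sup>2 \<le> (exp (L * t) * norm (?d 0))\<^sup>2"
    by (simp add: power_mult_distrib exp_double[symmetric] mult.assoc)
  then show ?thesis by (rule power2_le_imp_le) simp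
qed

lemma solutions_separate_at_most_exponentially:
  fixes X Y :: "real \<Rightarrow> 'a::real_inner"
  assumes Lip: "\<And>x y. x \<in> S \<Longrightarrow> y \<in> S \<Longrightarrow> norm (g x - g y) \<le> L * norm (x - y)"
    and X: "\<And>t. X t \<in> S" "\<And>t. (X has_vector_derivative g (X t)) (at t)"
    and Y: "\<And>t. Y t \<in> S" "\<And>t. (Y has_vector_derivative g (Y t)) (at t)"
  shows "norm (X t - Y t) \<le> exp (L * \<bar>t\<bar>) * norm (X 0 - Y 0)"
proof (cases "t \<ge> 0")
  case True
  then show ?thesis
    using solutions_separate_at_most_exponentially_forward[of S g L X Y t] assms by simp
next
  case False
  have rev: "((\<lambda>s. Z (- s)) has_vector_derivative - g (Z (- s))) (at s)"
    if "\<And>t. (Z has_vector_derivative g (Z t)) (at t)" for Z :: "real \<Rightarrow> 'a" and s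
  proof -
    have "(uminus has_vector_derivative - 1) (at s)"
      by (auto intro!: derivative_eq_intros)
    from vector_diff_chain_at[OF this that] show ?thesis by (simp add: o_def)
  qed
  show ?thesis
    using solutions_separate_at_most_exponentially_forward
        [of S "\<lambda>x. - g x" L "\<lambda>s. X (- s)" "\<lambda>s. Y (- s)" "- t"] False
      rev[OF X(2)] rev[OF Y(2)] Lip X(1) Y(1) by (simp add: norm_minus_commute)
qed

section \<open>The flow, its symmetries and the network\<close>

lemma vector_4:
  "(vector [x, y, z, w] :: ('a::zero)^4) $ 1 = x"
  "(vector [x, y, z, w] :: ('a::zero)^4) $ 2 = y"
  "(vector [x, y, z, w] :: ('a::zero)^4) $ 3 = z"
  "(vector [x, y, z, w] :: ('a::zero)^4) $ 4 = w"
  unfolding vector_def by simp_all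

lemma Gamma1_nth:
  "Gamma1 x $ 1 = - x $ 1" "Gamma1 x $ 2 = - x $ 2" "Gamma1 x $ 3 = x $ 3" "Gamma1 x $ 4 = x $ 4"
  by (simp_all add: Gamma1_def vector_4)

lemma Gamma2_nth:
  "Gamma2 x $ 1 = x $ 1" "Gamma2 x $ 2 = x $ 2" "Gamma2 x $ 3 = - x $ 3" "Gamma2 x $ 4 = x $ 4"
  by (simp_all add: Gamma2_def vector_4)

lemma Gamma1_fixed_iff: "Gamma1 x = x \<longleftrightarrow> x $ 1 = 0 \<and> x $ 2 = 0"
  by (auto simp: vec_eq_iff forall_4 Gamma1_nth)

lemma Gamma2_fixed_iff: "Gamma2 x = x \<longleftrightarrow> x $ 3 = 0"
  by (auto simp: vec_eq_iff forall_4 Gamma2_nth)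

lemma linear_Gamma1: "linear Gamma1"
  by (rule linearI) (simp_all add: Gamma1_def vec_eq_iff forall_4 vector_4)

lemma linear_Gamma2: "linear Gamma2"
  by (rule linearI) (simp_all add: Gamma2_def vec_eq_iff forall_4 vector_4)

lemma Gamma1_involution [simp]: "Gamma1 (Gamma1 x) = x"
  by (simp add: Gamma1_def vec_eq_iff forall_4 vector_4)

lemma Gamma2_involution [simp]: "Gamma2 (Gamma2 x) = x"
  by (simp add: Gamma2_def vec_eq_iff forall_4 vector_4)

lemma norm_Gamma1 [simp]: "norm (Gamma1 x) = norm x"
  by (simp add: Gamma1_def norm_vec_def L2_set_def sum_4 vector_4)

lemma norm_Gamma2 [simp]: "norm (Gamma2 x) = norm x"
  by (simp add: Gamma2_def norm_vec_def L2_set_def sum_4 vector_4)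

lemma Gamma_sigma [simp]:
  "Gamma1 sigma1 = sigma1" "Gamma1 sigma2 = sigma2" "Gamma2 sigma1 = sigma1" "Gamma2 sigma2 = sigma2"
  by (simp_all add: Gamma1_def Gamma2_def sigma1_def sigma2_def vec_eq_iff forall_4 vector_4)

lemma sigma_in_S3 [simp]: "sigma1 \<in> S3" "sigma2 \<in> S3"
  by (simp_all add: sigma1_def sigma2_def norm_vec_def L2_set_def sum_4 vector_4)

lemma norm_sigma [simp]: "norm sigma1 = 1" "norm sigma2 = 1"
  using sigma_in_S3 by auto

lemma sigma_in_Fix [simp]:
  "sigma1 \<in> Fix Gamma1" "sigma2 \<in> Fix Gamma1" "sigma1 \<in> Fix Gamma2" "sigma2 \<in> Fix Gamma2"
  using sigma_in_S3 by (simp_all add: Fix_def)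

context bykov_field
begin

lemma flow_in_S3 [simp]: "x \<in> S3 \<Longrightarrow> \<phi> t x \<in> S3"
  and flow_0 [simp]: "x \<in> S3 \<Longrightarrow> \<phi> 0 x = x"
  and flow_has_derivative:
    "x \<in> S3 \<Longrightarrow> ((\<lambda>s. \<phi> s x) has_vector_derivative f (\<phi> t x)) (at t)"
  using flow by (auto simp: is_flow_def simp del: mem_sphere)

lemma norm_flow [simp]: "norm x = 1 \<Longrightarrow> norm (\<phi> t x) = 1"
  using flow_in_S3[of x t] by simp

lemma flow_isCont: "x \<in> S3 \<Longrightarrow> isCont (\<lambda>s. \<phi> s x) t"
  using flow_has_derivative has_vector_derivative_continuous by blast

lemma flow_continuous_on: "x \<in> S3 \<Longrightarrow> continuous_on A (\<lambda>s. \<phi> s x)"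
  using flow_isCont continuous_at_imp_continuous_on by blast

lemma field_C1: "Ck_on (Suc (r - 1)) (radial_ext f) (- {0})"
  using field r_ge by (auto simp: Cr_vector_field_def simp del: Ck_on.simps)

lemma field_Lipschitz: "\<exists>L\<ge>0. \<forall>x\<in>S3. \<forall>y\<in>S3. norm (f x - f y) \<le> L * norm (x - y)"
  by (rule Lipschitz_of_C1_radial_ext[OF field_C1])

lemma flow_unique:
  assumes "\<And>t. X t \<in> S3" "\<And>t. (X has_vector_derivative f (X t)) (at t)"
  shows "X t = \<phi> t (X 0)"
proof -
  obtain L where L: "\<And>x y. x \<in> S3 \<Longrightarrow> y \<in> S3 \<Longrightarrow> norm (f x - f y) \<le> L * norm (x - y)"
    using field_Lipschitz by blast
  have "norm (X t - \<phi> t (X 0)) \<le> exp (L * \<bar>t\<bar>) * norm (X 0 - \<phi> 0 (X 0))"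
    by (rule solutions_separate_at_most_exponentially[OF L])
      (use assms flow_in_S3 flow_has_derivative in blast)+
  then show ?thesis using assms(1)[of 0] by simp
qed

lemma flow_dist:
  "\<exists>L\<ge>0. \<forall>x\<in>S3. \<forall>y\<in>S3. \<forall>t. dist (\<phi> t x) (\<phi> t y) \<le> exp (L * \<bar>t\<bar>) * dist x y"
proof -
  obtain L where L: "L \<ge> 0" "\<And>x y. x \<in> S3 \<Longrightarrow> y \<in> S3 \<Longrightarrow> norm (f x - f y) \<le> L * norm (x - y)"
    using field_Lipschitz by blast
  have "dist (\<phi> t x) (\<phi> t y) \<le> exp (L * \<bar>t\<bar>) * dist x y" if xy: "x \<in> S3" "y \<in> S3" for x y t
  proof -
    have "norm (\<phi> t x - \<phi> t y) \<le> exp (L * \<bar>t\<bar>) * norm (\<phi> 0 x - \<phi> 0 y)"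
      by (rule solutions_separate_at_most_exponentially[OF L(2)])
        (use xy flow_in_S3 flow_has_derivative in blast)+
    then show ?thesis using xy by (simp add: dist_norm)
  qed
  then show ?thesis using L(1) by blast
qed

lemma flow_tendsto:
  assumes "\<And>n. y n \<in> S3" "x \<in> S3" "(y \<longlongrightarrow> x) F"
  shows "((\<lambda>n. \<phi> t (y n)) \<longlongrightarrow> \<phi> t x) F"
proof -
  obtain L where L: "\<And>n. dist (\<phi> t (y n)) (\<phi> t x) \<le> exp (L * \<bar>t\<bar>) * dist (y n) x"
    using flow_dist assms by blast
  have "((\<lambda>n. exp (L * \<bar>t\<bar>) * dist (y n) x) \<longlongrightarrow> 0) F"
    using tendsto_mult_right_zero[OF tendsto_dist_iff[THEN iffD1, OF assms(3)]] by simp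
  then have "((\<lambda>n. dist (\<phi> t (y n)) (\<phi> t x)) \<longlongrightarrow> 0) F"
    by (rule Lim_null_comparison[rotated]) (simp add: L)
  then show ?thesis by (rule tendsto_dist_iff[THEN iffD2])
qed

lemma flow_add:
  assumes "x \<in> S3"
  shows "\<phi> s (\<phi> t x) = \<phi> (s + t) x"
proof -
  have "((\<lambda>s. \<phi> (s + t) x) has_vector_derivative f (\<phi> (s + t) x)) (at s)" for s
  proof -
    have "((\<lambda>s. s + t) has_vector_derivative 1) (at s)"
      by (auto intro!: derivative_eq_intros)
    from vector_diff_chain_at[OF this flow_has_derivative[OF assms]] show ?thesis
      by (simp add: o_def)
  qed
  from flow_unique[of "\<lambda>s. \<phi> (s + t) x", OF _ this] show ?thesis using assms by simp
qed

text \<open>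
  A symmetry of the field maps solutions to solutions, and solutions are unique.
\<close>

lemma flow_equivariant:
  assumes "linear \<Gamma>" "\<And>x. norm (\<Gamma> x) = norm x" "\<And>x. x \<in> S3 \<Longrightarrow> f (\<Gamma> x) = \<Gamma> (f x)" "x \<in> S3"
  shows "\<phi> t (\<Gamma> x) = \<Gamma> (\<phi> t x)"
proof -
  have "((\<lambda>t. \<Gamma> (\<phi> t x)) has_vector_derivative f (\<Gamma> (\<phi> t x))) (at t)" for t
    using bounded_linear.has_vector_derivative[OF _ flow_has_derivative[OF assms(4)], of \<Gamma> t]
      assms flow_in_S3[OF assms(4)] by (simp add: linear_conv_bounded_linear del: mem_sphere)
  from flow_unique[of "\<lambda>t. \<Gamma> (\<phi> t x)", OF _ this] show ?thesis using assms by simp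
qed

lemma flow_Gamma1: "x \<in> S3 \<Longrightarrow> \<phi> t (Gamma1 x) = Gamma1 (\<phi> t x)"
  using P1 by (intro flow_equivariant linear_Gamma1) auto

lemma flow_Gamma2: "x \<in> S3 \<Longrightarrow> \<phi> t (Gamma2 x) = Gamma2 (\<phi> t x)"
  using P1 by (intro flow_equivariant linear_Gamma2) auto

lemma flow_sigma [simp]: "\<phi> t sigma1 = sigma1" "\<phi> t sigma2 = sigma2"
  using flow_unique[of "\<lambda>_. sigma1" t] flow_unique[of "\<lambda>_. sigma2" t] P2_equilibria
  by (auto intro!: derivative_eq_intros)

lemma flow_in_Fix_iff:
  assumes "x \<in> S3"
  shows "\<phi> t x \<in> Fix Gamma1 \<longleftrightarrow> x \<in> Fix Gamma1" "\<phi> t x \<in> Fix Gamma2 \<longleftrightarrow> x \<in> Fix Gamma2"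
proof -
  have inj: "y = z" if "\<phi> t y = \<phi> t z" "y \<in> S3" "z \<in> S3" for y z
  proof -
    have "\<phi> (- t) (\<phi> t y) = \<phi> (- t) (\<phi> t z)" by (rule arg_cong[OF that(1)])
    then show ?thesis unfolding flow_add[OF that(2)] flow_add[OF that(3)] using that by simp
  qed
  show "\<phi> t x \<in> Fix Gamma1 \<longleftrightarrow> x \<in> Fix Gamma1" "\<phi> t x \<in> Fix Gamma2 \<longleftrightarrow> x \<in> Fix Gamma2"
    using inj[of "Gamma1 x" x] inj[of "Gamma2 x" x] flow_Gamma1[of x t] flow_Gamma2[of x t] assms
    by (auto simp: Fix_def)
qed

lemma heteroclinic_flow:
  assumes "x \<in> heteroclinic \<phi> p q"
  shows "\<phi> t x \<in> heteroclinic \<phi> p q"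
proof -
  have x: "x \<in> S3" "((\<lambda>t. \<phi> t x) \<longlongrightarrow> p) at_bot" "((\<lambda>t. \<phi> t x) \<longlongrightarrow> q) at_top"
    using assms by (auto simp: heteroclinic_def)
  have "filterlim (\<lambda>s. s + t) at_top at_top"
    unfolding filterlim_at_top eventually_at_top_linorder
    by (metis diff_le_eq)
  moreover have "filterlim (\<lambda>s. s + t) at_bot at_bot"
    unfolding filterlim_at_bot eventually_at_bot_linorder
    by (metis le_diff_eq)
  ultimately have "((\<lambda>s. \<phi> (s + t) x) \<longlongrightarrow> p) at_bot" "((\<lambda>s. \<phi> (s + t) x) \<longlongrightarrow> q) at_top"
    using filterlim_compose[OF x(2)] filterlim_compose[OF x(3)] by auto
  then show ?thesis using x flow_in_S3 by (simp add: heteroclinic_def flow_add)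
qed

lemma Fix_Gamma1_heteroclinic: "Fix Gamma1 - {sigma1, sigma2} \<subseteq> heteroclinic \<phi> sigma1 sigma2"
proof -
  obtain Q1 Q2 where Q: "Q1 \<in> heteroclinic \<phi> sigma1 sigma2" "Q2 \<in> heteroclinic \<phi> sigma1 sigma2"
    "Fix Gamma1 = {sigma1, sigma2} \<union> orbit \<phi> Q1 \<union> orbit \<phi> Q2"
    using P3 by blast
  then show ?thesis using heteroclinic_flow by (auto simp: orbit_def)
qed

text \<open>
  This description makes it visible that the network is compact and invariant, and that a point of a
  cylinder lies on it iff one of its coordinates \<open>w\<close> and \<open>z\<close> vanishes.
\<close>

lemma network_eq: "network \<phi> = Fix Gamma1 \<union> Fix Gamma2"
  using Fix_Gamma1_heteroclinic P4 by (auto simp: network_def)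

lemma network_subset_S3: "network \<phi> \<subseteq> S3"
  unfolding network_eq by (auto simp: Fix_def)

lemma compact_network: "compact (network \<phi>)"
proof -
  have "compact (Fix \<Gamma>)" if "linear \<Gamma>" for \<Gamma> :: "real^4 \<Rightarrow> real^4"
  proof -
    have "closed {x. \<Gamma> x = x}"
      using that by (intro closed_Collect_eq linear_continuous_on continuous_on_id)
        (simp add: linear_conv_bounded_linear)
    then have "compact (S3 \<inter> {x. \<Gamma> x = x})" by (intro compact_Int_closed) auto
    then show ?thesis by (simp add: Fix_def Int_def)
  qed
  then show ?thesis unfolding network_eq
    by (intro compact_Un) (simp_all add: linear_Gamma1 linear_Gamma2)
qed

lemma flow_in_network_iff: "x \<in> S3 \<Longrightarrow> \<phi> t x \<in> network \<phi> \<longleftrightarrow> x \<in> network \<phi>"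
  unfolding network_eq by (simp add: flow_in_Fix_iff del: mem_sphere)

lemma network_cases:
  assumes "y \<in> network \<phi>"
  obtains "y = sigma1" | "y = sigma2"
    | "((\<lambda>t. \<phi> t y) \<longlongrightarrow> sigma1) at_bot" "((\<lambda>t. \<phi> t y) \<longlongrightarrow> sigma2) at_top"
    | "((\<lambda>t. \<phi> t y) \<longlongrightarrow> sigma2) at_bot" "((\<lambda>t. \<phi> t y) \<longlongrightarrow> sigma1) at_top"
  using assms that unfolding network_def heteroclinic_def by auto

lemma Gamma2_in_network_iff: "Gamma2 x \<in> network \<phi> \<longleftrightarrow> x \<in> network \<phi>"
proof -
  have "Gamma1 (Gamma2 x) = Gamma2 (Gamma1 x)" for x
    by (simp add: Gamma1_def Gamma2_def vec_eq_iff forall_4 vector_4)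
  moreover have inj: "Gamma2 y = Gamma2 z \<longleftrightarrow> y = z" for y z
    by (metis Gamma2_involution)
  ultimately show ?thesis
    unfolding network_eq Fix_def by (auto simp: inj)
qed

end

section \<open>Basin trajectories are close to the equilibria on average\<close>

text \<open>
  Averages of this function measure the time spent away from the equilibria. It vanishes exactly
  there, and it is 1-Lipschitz, so that its averages inherit the continuity of the flow in the initial
  point.
\<close>

abbreviation eq_dist :: "real^4 \<Rightarrow> real" where
  "eq_dist x \<equiv> infdist x {sigma1, sigma2}"

lemma eq_dist_le_2:
  assumes "x \<in> S3"
  shows "eq_dist x \<le> 2"
proof -
  have "eq_dist x \<le> dist x sigma1" by (rule infdist_le) simp
  also have "\<dots> \<le> norm x + norm sigma1" unfolding dist_norm by (rule norm_triangle_ineq4)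
  finally show ?thesis using assms by simp
qed

lemma integral_split:
  fixes g :: "real \<Rightarrow> real"
  assumes "continuous_on UNIV g" "u \<le> v" "v \<le> w"
  shows "integral {u..w} g = integral {u..v} g + integral {v..w} g"
  by (rule Henstock_Kurzweil_Integration.integral_combine[symmetric])
     (auto intro: assms integrable_continuous_real continuous_on_subset[OF assms(1)])

lemma integral_le_const:
  fixes g :: "real \<Rightarrow> real"
  assumes "continuous_on UNIV g" "u \<le> v" "\<And>s. u \<le> s \<Longrightarrow> s \<le> v \<Longrightarrow> g s \<le> c"
  shows "integral {u..v} g \<le> (v - u) * c"
  using integral_le[of g "{u..v}" "\<lambda>_. c"] assms
  by (auto intro: integrable_continuous_real continuous_on_subset[OF assms(1)])

text \<open>
  The interval is chosen so long that its initial part, on which only the bound \<open>D\<close> is available,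
  contributes at most half of the admitted average.
\<close>

lemma exists_small_average_of_vanishing:
  fixes g :: "real \<Rightarrow> real"
  assumes g: "continuous_on UNIV g" "\<And>s. g s \<le> D" "(g \<longlongrightarrow> 0) at_top" and "e > 0"
  shows "\<exists>T\<ge>1. integral {0..T} g \<le> e * T"
proof -
  have D: "D \<ge> 0"
    by (rule tendsto_upperbound[OF g(3)]) (simp_all add: g(2))
  have "\<forall>\<^sub>F s in at_top. g s < e / 2"
    using g(3) \<open>e > 0\<close> by (intro order_tendstoD) auto
  then obtain S where S: "\<And>s. s \<ge> S \<Longrightarrow> g s < e / 2"
    unfolding eventually_at_top_linorder by blast
  define S' where "S' = max 0 S"
  define T where "T = max 1 (max S' (2 * S' * D / e))"
  have "0 \<le> S'" by (simp add: S'_def)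
  then have T: "T \<ge> 1" "0 \<le> S'" "S' \<le> T" "2 * S' * D / e \<le> T"
    by (simp_all add: T_def)
  have "integral {0..T} g = integral {0..S'} g + integral {S'..T} g"
    using T by (intro integral_split g(1)) auto
  also have "integral {0..S'} g \<le> (S' - 0) * D"
    using T by (intro integral_le_const g) auto
  also have "integral {S'..T} g \<le> (T - S') * (e / 2)"
    using T S by (intro integral_le_const g) (auto simp: S'_def less_imp_le)
  also have "\<dots> \<le> T * (e / 2)"
    using T \<open>e > 0\<close> by (intro mult_right_mono) auto
  also have "(S' - 0) * D + T * (e / 2) \<le> e * T"
    using T(4) \<open>e > 0\<close> by (simp add: field_simps)
  finally show ?thesis using T(1) by auto
qed

context bykov_field
begin

lemma flow_eq_dist_continuous:
  assumes "x \<in> S3"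
  shows "continuous_on A (\<lambda>s. eq_dist (\<phi> s x))"
  by (intro continuous_intros flow_continuous_on assms)

lemma network_eq_dist_tendsto_0:
  assumes "y \<in> network \<phi>"
  shows "((\<lambda>t. eq_dist (\<phi> t y)) \<longlongrightarrow> 0) at_top"
proof -
  have "\<exists>s\<in>{sigma1, sigma2}. ((\<lambda>t. \<phi> t y) \<longlongrightarrow> s) at_top"
    using assms by (rule network_cases) auto
  then obtain s where s: "s \<in> {sigma1, sigma2}" "((\<lambda>t. \<phi> t y) \<longlongrightarrow> s) at_top" by blast
  then have "((\<lambda>t. eq_dist (\<phi> t y)) \<longlongrightarrow> eq_dist s) at_top"
    by (intro tendsto_infdist)
  then show ?thesis using s(1) by simp
qed

text \<open>
  Forward orbits of the network converge to an equilibrium, so they have small averages over some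
  time \<open>T\<close>. For fixed \<open>T\<close> this persists under small changes of the initial point.
\<close>

lemma network_local_average:
  assumes q: "q \<in> network \<phi>" and "e > 0"
  shows "\<exists>T\<ge>1. \<exists>d>0. \<forall>x\<in>S3 \<inter> ball q d. integral {0..T} (\<lambda>s. eq_dist (\<phi> s x)) \<le> e * T"
proof -
  have qS: "q \<in> S3" using q network_subset_S3 by blast
  have "\<exists>T\<ge>1. integral {0..T} (\<lambda>s. eq_dist (\<phi> s q)) \<le> e / 2 * T"
    using \<open>e > 0\<close> by (intro exists_small_average_of_vanishing[where D = 2] flow_eq_dist_continuous
        eq_dist_le_2 flow_in_S3 qS network_eq_dist_tendsto_0 q) simp
  then obtain T where T: "T \<ge> 1" "integral {0..T} (\<lambda>s. eq_dist (\<phi> s q)) \<le> e / 2 * T"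
    by blast
  obtain L where L: "L \<ge> 0" "\<And>x y t. x \<in> S3 \<Longrightarrow> y \<in> S3 \<Longrightarrow>
      dist (\<phi> t x) (\<phi> t y) \<le> exp (L * \<bar>t\<bar>) * dist x y"
    using flow_dist by blast
  define d where "d = e / 2 / exp (L * T)"
  have "integral {0..T} (\<lambda>s. eq_dist (\<phi> s x)) \<le> e * T" if x: "x \<in> S3" "x \<in> ball q d" for x
  proof -
    have "eq_dist (\<phi> s x) \<le> eq_dist (\<phi> s q) + e / 2" if s: "s \<in> {0..T}" for s
    proof -
      have "eq_dist (\<phi> s x) \<le> eq_dist (\<phi> s q) + dist (\<phi> s x) (\<phi> s q)"
        by (rule infdist_triangle)
      also have "dist (\<phi> s x) (\<phi> s q) \<le> exp (L * \<bar>s\<bar>) * dist x q"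
        using L(2) x qS by blast
      also have "\<dots> \<le> exp (L * T) * d"
        using s x L(1) by (intro mult_mono) (auto simp: dist_commute mult_left_mono)
      also have "\<dots> = e / 2" by (simp add: d_def)
      finally show ?thesis by simp
    qed
    then have "integral {0..T} (\<lambda>s. eq_dist (\<phi> s x))
        \<le> integral {0..T} (\<lambda>s. eq_dist (\<phi> s q) + e / 2)"
      using x qS
      by (intro integral_le integrable_continuous_real continuous_intros flow_continuous_on) auto
    also have "\<dots> = integral {0..T} (\<lambda>s. eq_dist (\<phi> s q)) + integral {0..T} (\<lambda>s. e / 2)"
      using qS by (intro Henstock_Kurzweil_Integration.integral_add integrable_continuous_real
          flow_eq_dist_continuous continuous_intros)
    also have "\<dots> \<le> e * T" using T by (simp add: field_simps)
    finally show ?thesis .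
  qed
  moreover have "d > 0" using \<open>e > 0\<close> by (simp add: d_def)
  ultimately show ?thesis using T(1) by blast
qed

text \<open>
  Otherwise compactness of the sphere would give an accumulation point outside \<open>U\<close>.
\<close>

lemma eventually_in_nbhd_of_omega_limit:
  assumes "x \<in> S3" "open U" "omega_limit \<phi> x \<subseteq> U"
  shows "\<forall>\<^sub>F t in at_top. \<phi> t x \<in> U"
proof (rule ccontr)
  assume "\<not> ?thesis"
  then have "\<forall>n. \<exists>t\<ge>real n. \<phi> t x \<notin> U"
    unfolding eventually_at_top_linorder by blast
  then obtain s where s: "\<And>n. s n \<ge> real n" "\<And>n. \<phi> (s n) x \<notin> U" by metis
  obtain y k where y: "strict_mono k" "((\<lambda>n. \<phi> (s n) x) \<circ> k) \<longlonglongrightarrow> y"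
    using compact_sphere[of "0::real^4" 1, unfolded compact_def, rule_format, of "\<lambda>n. \<phi> (s n) x"]
      flow_in_S3[OF assms(1)] by (auto simp del: mem_sphere)
  have "filterlim s at_top sequentially"
    using filterlim_at_top_mono[OF filterlim_real_sequentially] s(1) by simp
  then have "filterlim (s \<circ> k) at_top sequentially"
    using filterlim_compose filterlim_subseq[OF y(1)] by (auto simp: o_def)
  then have "y \<in> omega_limit \<phi> x"
    using y(2) unfolding omega_limit_def by (auto simp: o_def)
  moreover have "y \<in> - U"
    using y(2) s(2) assms(2) by (intro closed_sequentially[of "- U" "(\<lambda>n. \<phi> (s n) x) \<circ> k" y]) auto
  ultimately show False using assms(3) by auto
qed

text \<open>
  Finitely many of the neighbourhoods from \<open>network_local_average\<close> cover the compact network, and the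
  trajectory eventually stays in their union. At each late time one of finitely many block lengths is
  therefore available over which the average is at most \<open>e\<close>. The interval is filled greedily with such
  blocks, and the incomplete last block accounts for the constant \<open>K\<close>.
\<close>

lemma eq_dist_integral_bound:
  assumes x: "x \<in> S3" "omega_limit \<phi> x \<subseteq> network \<phi>" and "e > 0"
  shows "\<exists>T0\<ge>0. \<exists>K. \<forall>t\<ge>T0. \<forall>l\<ge>0. integral {t..t + l} (\<lambda>s. eq_dist (\<phi> s x)) \<le> e * l + K"
proof -
  let ?g = "\<lambda>s. eq_dist (\<phi> s x)"
  obtain T d where Td: "\<And>q. q \<in> network \<phi> \<Longrightarrow> T q \<ge> 1 \<and> d q > 0 \<and>
      (\<forall>y\<in>S3 \<inter> ball q (d q). integral {0..T q} (\<lambda>s. eq_dist (\<phi> s y)) \<le> e * T q)"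
  proof -
    have "\<forall>q\<in>network \<phi>. \<exists>p. fst p \<ge> 1 \<and> snd p > 0 \<and>
      (\<forall>y\<in>S3 \<inter> ball q (snd p). integral {0..fst p} (\<lambda>s. eq_dist (\<phi> s y)) \<le> e * fst p)"
      using network_local_average[OF _ \<open>e > 0\<close>] by fastforce
    from bchoice[OF this] obtain p where "\<forall>q\<in>network \<phi>. fst (p q) \<ge> 1 \<and> snd (p q) > 0 \<and>
      (\<forall>y\<in>S3 \<inter> ball q (snd (p q)). integral {0..fst (p q)} (\<lambda>s. eq_dist (\<phi> s y)) \<le> e * fst (p q))"
      ..
    then show thesis by (intro that[of "\<lambda>q. fst (p q)" "\<lambda>q. snd (p q)"]) simp
  qed
  have "network \<phi> \<subseteq> (\<Union>q\<in>network \<phi>. ball q (d q))" using Td by force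
  then obtain C where C: "C \<subseteq> network \<phi>" "finite C" "network \<phi> \<subseteq> (\<Union>q\<in>C. ball q (d q))"
    by (rule compactE_image[OF compact_network, of "network \<phi>" "\<lambda>q. ball q (d q)", rotated]) auto
  have "\<forall>\<^sub>F t in at_top. \<phi> t x \<in> (\<Union>q\<in>C. ball q (d q))"
    using x C(3) by (intro eventually_in_nbhd_of_omega_limit) auto
  then obtain T1 where T1: "\<And>t. t \<ge> T1 \<Longrightarrow> \<phi> t x \<in> (\<Union>q\<in>C. ball q (d q))"
    unfolding eventually_at_top_linorder by blast
  define Tm where "Tm = Max (insert 1 (T ` C))"
  have Tm: "Tm \<ge> 1" "\<And>q. q \<in> C \<Longrightarrow> T q \<le> Tm"
    using C(2) by (auto simp: Tm_def)
  have cont: "continuous_on UNIV ?g" using x(1) by (rule flow_eq_dist_continuous)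
  \<comment> \<open>Blocks of length at least \<open>1\<close>, so that finitely many of them fill the interval.\<close>
  have step: "\<exists>u\<ge>1. u \<le> Tm \<and> integral {t..t + u} ?g \<le> e * u" if "t \<ge> T1" for t
  proof -
    obtain q where q: "q \<in> C" "\<phi> t x \<in> ball q (d q)" using T1[OF \<open>t \<ge> T1\<close>] by blast
    have "integral {0..T q} (\<lambda>s. eq_dist (\<phi> s (\<phi> t x))) \<le> e * T q"
      using Td C(1) q flow_in_S3[OF x(1)] by blast
    moreover have "integral {t..t + T q} ?g = integral {0..T q} (\<lambda>s. ?g (s + t))"
      using integral_shift_Icc_real[of 0 "T q" ?g t] by (simp add: o_def add.commute)
    ultimately have "integral {t..t + T q} ?g \<le> e * T q" by (simp add: flow_add[OF x(1)])
    moreover have "T q \<ge> 1" "T q \<le> Tm" using Td Tm(2) C(1) q(1) by blast+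
    ultimately show ?thesis by blast
  qed
  have "integral {t..t + l} ?g \<le> e * l + 2 * Tm" if "t \<ge> T1" "0 \<le> l" "l \<le> real n" for n t l
    using that
  proof (induction n arbitrary: t l)
    case 0
    then show ?case using Tm by simp
  next
    case (Suc n)
    obtain u where u: "u \<ge> 1" "u \<le> Tm" "integral {t..t + u} ?g \<le> e * u"
      using step Suc.prems by blast
    show ?case
    proof (cases "u \<le> l")
      case True
      have "integral {t..t + l} ?g = integral {t..t + u} ?g + integral {t + u..(t + u) + (l - u)} ?g"
        using u True integral_split[OF cont, of t "t + u" "t + l"] by simp
      also have "\<dots> \<le> e * u + (e * (l - u) + 2 * Tm)"
        using u True Suc.prems by (intro add_mono Suc.IH) auto
      finally show ?thesis by (simp add: algebra_simps)
    next
      case False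
      have "integral {t..t + l} ?g \<le> (t + l - t) * 2"
        using Suc.prems eq_dist_le_2 flow_in_S3[OF x(1)] by (intro integral_le_const cont) auto
      also have "\<dots> \<le> 0 + 2 * Tm" using False u(2) by simp
      also have "\<dots> \<le> e * l + 2 * Tm"
        using \<open>e > 0\<close> Suc.prems(2) by (intro add_right_mono) simp
      finally show ?thesis .
    qed
  qed
  then have "\<forall>t\<ge>max 0 T1. \<forall>l\<ge>0. integral {t..t + l} ?g \<le> e * l + 2 * Tm"
    by (metis max.bounded_iff real_arch_simple)
  then show ?thesis by (intro exI[of _ "max 0 T1"]) auto
qed

text \<open>
  In terms of ergodic theory: the limits of the empirical measures of the trajectory are invariant
  measures on the network, and these are carried by the two equilibria.
\<close>

lemma eq_dist_average_tendsto_0: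
  assumes x: "x \<in> S3" "omega_limit \<phi> x \<subseteq> network \<phi>"
  shows "((\<lambda>t. integral {0..t} (\<lambda>s. eq_dist (\<phi> s x)) / t) \<longlongrightarrow> 0) at_top"
proof (rule tendstoI)
  fix e :: real assume "e > 0"
  let ?g = "\<lambda>s. eq_dist (\<phi> s x)"
  obtain T0 K where K: "T0 \<ge> 0" "\<And>t l. t \<ge> T0 \<Longrightarrow> l \<ge> 0 \<Longrightarrow> integral {t..t + l} ?g \<le> e / 2 * l + K"
    using eq_dist_integral_bound[OF x, of "e / 2"] \<open>e > 0\<close> by auto
  have cont: "continuous_on UNIV ?g" using x(1) by (rule flow_eq_dist_continuous)
  have "\<forall>\<^sub>F t in at_top. t > max (max T0 1) (2 * (2 * T0 + K) / e)"
    by (rule eventually_gt_at_top)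
  then show "\<forall>\<^sub>F t in at_top. dist (integral {0..t} ?g / t) 0 < e"
  proof eventually_elim
    case (elim t)
    have "integral {0..t} ?g = integral {0..T0} ?g + integral {T0..T0 + (t - T0)} ?g"
      using elim K integral_split[OF cont, of 0 T0 t] by simp
    also have "\<dots> \<le> (T0 - 0) * 2 + (e / 2 * (t - T0) + K)"
      using elim K(1) eq_dist_le_2 flow_in_S3[OF x(1)]
      by (intro add_mono K integral_le_const cont) auto
    also have "\<dots> \<le> e / 2 * t + (2 * T0 + K)"
      using K(1) \<open>e > 0\<close> by (simp add: algebra_simps)
    also have "\<dots> < e * t" using elim \<open>e > 0\<close> by (simp add: field_simps)
    finally have "integral {0..t} ?g / t < e" using elim by (simp add: field_simps)
    moreover have "integral {0..t} ?g \<ge> 0"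
      using cont by (intro integral_nonneg integrable_continuous_real)
        (auto intro: continuous_on_subset infdist_nonneg)
    ultimately show ?case using elim by simp
  qed
qed

end

section \<open>Expanding directions at the equilibria\<close>

lemma radial_ext_eq [simp]: "norm x = 1 \<Longrightarrow> radial_ext f x = f x"
  by (simp add: radial_ext_def)

lemma eq_uminus_self_iff [simp]: "x = - x \<longleftrightarrow> x = 0" for x :: "'a::real_vector"
proof
  assume "x = - x"
  then have "x + x = 0" by (metis add.right_inverse)
  then show "x = 0" by (simp add: scaleR_2[symmetric])
qed simp

context bykov_field
begin

lemma radial_ext_differentiable: "x \<noteq> 0 \<Longrightarrow> radial_ext f differentiable (at x)"
  using field_C1 by auto

lemma radial_ext_equivariant:
  assumes "linear \<Gamma>" "\<And>x. norm (\<Gamma> x) = norm x" "\<And>x. x \<in> S3 \<Longrightarrow> f (\<Gamma> x) = \<Gamma> (f x)" "x \<noteq> 0"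
  shows "radial_ext f (\<Gamma> x) = \<Gamma> (radial_ext f x)"
  using assms(3)[of "x /\<^sub>R norm x"] assms(2,4) linear_cmul[OF assms(1)]
  by (simp add: radial_ext_def)

lemma linearization_equivariant:
  assumes G: "linear \<Gamma>" "\<And>x. norm (\<Gamma> x) = norm x" "\<And>x. x \<in> S3 \<Longrightarrow> f (\<Gamma> x) = \<Gamma> (f x)"
    and s: "s \<in> S3" "\<Gamma> s = s"
  shows "linearization f s (\<Gamma> v) = \<Gamma> (linearization f s v)"
proof -
  let ?F = "radial_ext f" and ?L = "linearization f s"
  have nz: "s \<noteq> 0" using s(1) by auto
  have bl: "bounded_linear \<Gamma>" using G(1) by (simp add: linear_conv_bounded_linear)
  have L: "(?F has_derivative ?L) (at s)"
    unfolding linearization_def frechet_derivative_works[symmetric]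
    by (rule radial_ext_differentiable[OF nz])
  have "((\<lambda>x. ?F (\<Gamma> x)) has_derivative (\<lambda>v. ?L (\<Gamma> v))) (at s)"
    using diff_chain_at[OF bounded_linear_imp_has_derivative[OF bl], of ?F ?L s] L s(2)
    by (simp add: o_def)
  moreover have "((\<lambda>x. \<Gamma> (?F x)) has_derivative (\<lambda>v. \<Gamma> (?L v))) (at s)"
    by (rule bounded_linear.has_derivative[OF bl L])
  then have "((\<lambda>x. ?F (\<Gamma> x)) has_derivative (\<lambda>v. \<Gamma> (?L v))) (at s)"
    by (rule has_derivative_transform_within_open[of _ _ _ UNIV "- {0}"])
      (use nz radial_ext_equivariant[OF G] in auto)
  ultimately show ?thesis by (metis has_derivative_unique)
qed

lemma linear_linearization: "s \<in> S3 \<Longrightarrow> linear (linearization f s)"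
  unfolding linearization_def
  by (rule linear_frechet_derivative[OF radial_ext_differentiable]) auto

text \<open>
  The form \<open>(norm (M x))\<^sup>2\<close> measures the distance from the fixed space of \<open>\<Gamma>\<close>, and the hypothesis on
  \<open>c\<close> says that the linearization at \<open>s\<close> expands it. The field itself does not decrease it near \<open>s\<close>:
  at the midpoint of \<open>x\<close> and \<open>\<Gamma> x\<close> the image of the field under \<open>M\<close> is zero by symmetry, and by the
  mean value theorem along the segment from this midpoint to \<open>x\<close> it is at \<open>x\<close> what a derivative close
  to the linearization produces. On a trajectory that converges to \<open>s\<close>, where the form vanishes, a
  nondecreasing form must vanish throughout.
\<close>

lemma convergent_off_expanding_directions:
  fixes \<Gamma> :: "real^4 \<Rightarrow> real^4" and M :: "real^4 \<Rightarrow> 'b::euclidean_space"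
  assumes G: "linear \<Gamma>" "\<And>x. norm (\<Gamma> x) = norm x" "\<And>x. x \<in> S3 \<Longrightarrow> f (\<Gamma> x) = \<Gamma> (f x)"
      "\<And>x. \<Gamma> (\<Gamma> x) = x"
    and s: "s \<in> S3" "\<Gamma> s = s"
    and M: "linear M" "\<And>x. M (\<Gamma> x) = - M x" "\<And>x. M x = 0 \<Longrightarrow> \<Gamma> x = x"
    and c: "c > 0" "\<And>p. \<Gamma> p = - p \<Longrightarrow> c * (norm p)\<^sup>2 \<le> M p \<bullet> M (linearization f s p)"
    and P: "P \<in> S3" "((\<lambda>t. \<phi> t P) \<longlongrightarrow> s) at_top"
  shows "P \<in> Fix \<Gamma>"
proof -
  let ?F = "radial_ext f"
  let ?D = "\<lambda>x. frechet_derivative ?F (at x)"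
  interpret G: linear \<Gamma> by (rule G(1))
  interpret M: linear M by (rule M(1))
  have blM: "bounded_linear M" using M(1) by (simp add: linear_conv_bounded_linear)
  obtain K where K: "K > 0" "\<And>x. norm (M x) \<le> norm x * K"
    using bounded_linear.pos_bounded[OF blM] by blast
  \<comment> \<open>Two applications of \<open>M\<close> cost a factor \<open>K\<^sup>2\<close>, so an error of this size in the derivative is
    absorbed by \<open>c * (norm p)\<^sup>2\<close>.\<close>
  have "open (- {0} :: (real^4) set)" "s \<in> - {0}" "c / K\<^sup>2 > 0"
    using s(1) c(1) K(1) by auto
  then obtain d where d: "d > 0" "ball s d \<subseteq> - {0}"
    "\<And>y v. y \<in> ball s d \<Longrightarrow> norm (?D y v - ?D s v) \<le> c / K\<^sup>2 * norm v"
    using C1_derivative_close[OF _ field_C1] by metis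
  have expand: "M x \<bullet> M (?F x) \<ge> 0" if x: "x \<in> ball s d" for x
  proof -
    define p where "p = (1/2) *\<^sub>R (x - \<Gamma> x)"
    define x0 where "x0 = (1/2) *\<^sub>R (x + \<Gamma> x)"
    have Gp: "\<Gamma> p = - p" and Gx0: "\<Gamma> x0 = x0" and xp: "x0 + p = x"
      unfolding p_def x0_def
      by (simp_all add: G.scale G.diff G.add G(4) algebra_simps scaleR_2[symmetric])
    have Gball: "\<Gamma> x \<in> ball s d"
    proof -
      have "dist s (\<Gamma> x) = norm (\<Gamma> (s - x))" by (simp add: G.diff s(2) dist_norm)
      then show ?thesis using x G(2)[of "s - x"] by (simp add: dist_norm)
    qed
    have x0b: "x0 \<in> ball s d"
      using convexD[OF convex_ball x Gball, of "1/2" "1/2"] by (simp add: x0_def scaleR_add_right)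
    have seg: "x0 + t *\<^sub>R p \<in> ball s d" if "0 \<le> t" "t \<le> 1" for t
      using convexD[OF convex_ball x0b x, of "1 - t" t] that xp[symmetric]
      by (simp add: algebra_simps)
    \<comment> \<open>At the midpoint \<open>x0\<close> the field is fixed by \<open>\<Gamma>\<close>, which \<open>M\<close> turns into a change of sign.\<close>
    have M0: "M (?F x0) = 0"
    proof -
      have "x0 \<noteq> 0" using x0b d(2) by auto
      then have "M (?F x0) = - M (?F x0)"
        using radial_ext_equivariant[OF G(1-3), of x0] M(2)[of "?F x0"] Gx0 by simp
      then show ?thesis by simp
    qed
    have Mx: "M x = M p"
    proof -
      have "M x0 = - M x0" using M(2)[of x0] Gx0 by simp
      then show ?thesis using xp M.add[of x0 p] by simp
    qed
    let ?g = "\<lambda>t. M p \<bullet> M (?F (x0 + t *\<^sub>R p))"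
    have "(?g has_derivative (\<lambda>h. M p \<bullet> M (?D (x0 + t *\<^sub>R p) (h *\<^sub>R p)))) (at t)"
      if t: "0 \<le> t" "t \<le> 1" for t
    proof -
      have "x0 + t *\<^sub>R p \<noteq> 0" using seg[OF t] d(2) by auto
      then have "(?F has_derivative ?D (x0 + t *\<^sub>R p)) (at (x0 + t *\<^sub>R p))"
        using radial_ext_differentiable frechet_derivative_works by blast
      moreover have "((\<lambda>t. x0 + t *\<^sub>R p) has_derivative (\<lambda>h. h *\<^sub>R p)) (at t)"
        by (auto intro!: derivative_eq_intros)
      ultimately have "((\<lambda>t. ?F (x0 + t *\<^sub>R p)) has_derivative (\<lambda>h. ?D (x0 + t *\<^sub>R p) (h *\<^sub>R p))) (at t)"
        using diff_chain_at[of "\<lambda>t. x0 + t *\<^sub>R p" "\<lambda>h. h *\<^sub>R p" t ?F] by (simp add: o_def)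
      from has_derivative_inner_right[OF bounded_linear.has_derivative[OF blM this]]
      show ?thesis .
    qed
    then have "\<exists>t\<in>{0..1}. ?g 1 - ?g 0 = M p \<bullet> M (?D (x0 + t *\<^sub>R p) ((1 - 0) *\<^sub>R p))"
      by (intro mvt_very_simple) (auto intro: has_derivative_at_withinI)
    then obtain t where t: "0 \<le> t" "t \<le> 1" "?g 1 - ?g 0 = M p \<bullet> M (?D (x0 + t *\<^sub>R p) p)"
      by auto
    let ?e = "?D (x0 + t *\<^sub>R p) p - ?D s p"
    have "\<bar>M p \<bullet> M ?e\<bar> \<le> norm (M p) * norm (M ?e)" by (rule Cauchy_Schwarz_ineq2)
    also have "\<dots> \<le> (norm p * K) * (norm ?e * K)"
      using K by (intro mult_mono) auto
    also have "\<dots> \<le> (norm p * K) * ((c / K\<^sup>2 * norm p) * K)"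
      using K(1) d(3)[OF seg[OF t(1,2)]] by (intro mult_left_mono mult_right_mono) auto
    also have "\<dots> = c * (norm p)\<^sup>2" using K(1) by (simp add: power2_eq_square)
    also have "\<dots> \<le> M p \<bullet> M (?D s p)" using c(2)[OF Gp] by (simp add: linearization_def)
    finally have "0 \<le> M p \<bullet> M (?D s p) + M p \<bullet> M ?e" by linarith
    also have "\<dots> = M p \<bullet> M (?D (x0 + t *\<^sub>R p) p)"
      by (simp add: M.diff inner_diff_right)
    finally show ?thesis using t(3) M0 Mx xp by simp
  qed
  have "\<forall>\<^sub>F t in at_top. \<phi> t P \<in> ball s d"
    using tendstoD[OF P(2) d(1)] by (simp add: dist_commute)
  then obtain T where T: "\<And>t. t \<ge> T \<Longrightarrow> \<phi> t P \<in> ball s d"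
    unfolding eventually_at_top_linorder by blast
  let ?Q = "\<lambda>t. M (\<phi> t P) \<bullet> M (\<phi> t P)"
  have mono: "?Q T \<le> ?Q t" if "t \<ge> T" for t
  proof (rule DERIV_nonneg_imp_nondecreasing[OF that])
    fix u assume u: "T \<le> u" "u \<le> t"
    have "((\<lambda>t. M (\<phi> t P)) has_vector_derivative M (f (\<phi> u P))) (at u)"
      by (rule bounded_linear.has_vector_derivative[OF blM flow_has_derivative[OF P(1)]])
    from has_real_derivative_inner_self[OF this]
    show "\<exists>y. (?Q has_real_derivative y) (at u) \<and> 0 \<le> y"
      using expand[OF T[OF u(1)]] P(1)
      by (intro exI[of _ "2 * (M (\<phi> u P) \<bullet> M (f (\<phi> u P)))"] conjI) auto
  qed
  have "((\<lambda>t. M (\<phi> t P)) \<longlongrightarrow> M s) at_top"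
    by (rule bounded_linear.tendsto[OF blM P(2)])
  moreover have "M s = 0" using M(2)[of s] s(2) by simp
  ultimately have "((\<lambda>t. M (\<phi> t P)) \<longlongrightarrow> 0) at_top" by simp
  from tendsto_inner[OF this this] have "(?Q \<longlongrightarrow> 0 \<bullet> (0::'b)) at_top" .
  moreover have "\<forall>\<^sub>F t in at_top. ?Q T \<le> ?Q t"
    using mono eventually_at_top_linorder by blast
  ultimately have "?Q T \<le> 0 \<bullet> (0::'b)"
    by (intro tendsto_lowerbound[of ?Q _ at_top]) auto
  then have "M (\<phi> T P) = 0" by (metis inner_eq_zero_iff inner_ge_zero inner_zero_left order_antisym)
  then have fixT: "\<Gamma> (\<phi> T P) = \<phi> T P" by (rule M(3))
  have "\<phi> (- T) (\<Gamma> (\<phi> T P)) = \<Gamma> (\<phi> (- T) (\<phi> T P))"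
    by (rule flow_equivariant[OF G(1-3) flow_in_S3[OF P(1)]])
  then show ?thesis using P(1) by (simp add: fixT flow_add[OF P(1)] Fix_def)
qed

text \<open>
  The third axis is the space of vectors reversed by \<open>Gamma2\<close>, so the linearization, which commutes
  with \<open>Gamma2\<close>, preserves it.
\<close>

lemma linearization_axis3:
  assumes s: "s \<in> {sigma1, sigma2}"
  shows "linearization f s (axis 3 1) = (linearization f s (axis 3 1) $ 3) *\<^sub>R axis 3 1"
    and "complex_of_real (linearization f s (axis 3 1) $ 3) \<in> tangent_eigenvalues f s"
proof -
  let ?L = "linearization f s" and ?e = "axis 3 1 :: real^4"
  have sS: "s \<in> S3" and Gs: "Gamma2 s = s" using s by auto
  interpret L: linear ?L by (rule linear_linearization[OF sS])
  have "Gamma2 ?e = - ?e"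
    by (simp add: Gamma2_def vec_eq_iff forall_4 vector_4 axis_def)
  then have "Gamma2 (?L ?e) = - ?L ?e"
    using linearization_equivariant[OF linear_Gamma2 norm_Gamma2 _ sS Gs, of ?e] P1
    by (simp add: L.neg)
  then show *: "?L ?e = (?L ?e $ 3) *\<^sub>R ?e"
    by (simp add: Gamma2_def vec_eq_iff forall_4 vector_4 axis_def)
  have "?e \<bullet> s = 0" "?e \<noteq> 0"
    using s by (auto simp: inner_axis' sigma1_def sigma2_def vector_4)
  then show "complex_of_real (?L ?e $ 3) \<in> tangent_eigenvalues f s"
    unfolding tangent_eigenvalues_def
    by (intro CollectI exI[of _ ?e] exI[of _ 0]) (use * in \<open>auto simp: L.zero\<close>)
qed

text \<open>
  The third axis, transversal to the sphere \<open>Fix Gamma2\<close>, carries a real eigenvalue of the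
  linearization, and the only real one is \<open>E1 > 0\<close>.
\<close>

lemma convergent_to_sigma1:
  assumes "P \<in> S3" "((\<lambda>t. \<phi> t P) \<longlongrightarrow> sigma1) at_top"
  shows "P \<in> Fix Gamma2"
proof (rule convergent_off_expanding_directions[where M = "\<lambda>x. x $ 3" and c = E1])
  let ?L = "linearization f sigma1"
  interpret L: linear ?L by (rule linear_linearization) simp
  have "?L (axis 3 1) $ 3 = E1"
    using linearization_axis3(2)[of sigma1] P2_eigenvalues(1) P2_constants
    by (auto simp: complex_eq_iff)
  then have L3: "?L (axis 3 1) = E1 *\<^sub>R axis 3 1"
    using linearization_axis3(1)[of sigma1] by simp
  fix p assume "Gamma2 p = - p"
  then have p: "p = (p $ 3) *\<^sub>R axis 3 1"
    by (simp add: Gamma2_def vec_eq_iff forall_4 vector_4 axis_def)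
  have "?L p = (p $ 3 * E1) *\<^sub>R axis 3 1"
    by (subst p) (simp add: L.scale L3)
  moreover have "norm p = \<bar>p $ 3\<bar>"
    by (subst p) simp
  ultimately show "E1 * (norm p)\<^sup>2 \<le> p $ 3 \<bullet> ?L p $ 3"
    by (simp add: axis_def power2_eq_square)
qed (use assms P1 P2_constants in
    \<open>auto simp: linear_Gamma2 Gamma2_fixed_iff Gamma2_nth intro: linearI simp del: mem_sphere\<close>)

lemma eigenvalue_trace_det:
  fixes w1 w2 l :: complex and a b c d :: real
  assumes "of_real a * w1 + of_real b * w2 = l * w1" "of_real c * w1 + of_real d * w2 = l * w2"
    and "w1 \<noteq> 0 \<or> w2 \<noteq> 0"
  shows "(of_real a - l) * (of_real d - l) = of_real b * (of_real c :: complex)"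
proof -
  let ?D = "(of_real a - l) * (of_real d - l) - of_real b * (of_real c :: complex)"
  have "?D * w1 = 0" "?D * w2 = 0" using assms(1,2) by algebra+
  then show ?thesis using assms(3) by auto
qed

text \<open>
  On the plane of \<open>x$1\<close> and \<open>x$2\<close>, transversal to the circle \<open>Fix Gamma1\<close>, the linearization is \<open>E2 + N\<close>
  with \<open>N\<^sup>2 = - \<omega>2\<^sup>2\<close>, because its eigenvalues are \<open>E2 \<plusminus> \<i> \<omega>2\<close>. The matrix \<open>N\<close> need not be skew, so the
  Euclidean norm may decrease for some time. The form \<open>\<omega>2\<^sup>2 \<bar>x\<bar>\<^sup>2 + \<bar>N x\<bar>\<^sup>2\<close> is adapted to \<open>N\<close>: the inner
  product of \<open>x\<close> and \<open>N x\<close> for it is zero, and the expansion has exactly the rate \<open>E2\<close>.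
\<close>

lemma convergent_to_sigma2:
  assumes "P \<in> S3" "((\<lambda>t. \<phi> t P) \<longlongrightarrow> sigma2) at_top"
  shows "P \<in> Fix Gamma1"
proof -
  let ?L = "linearization f sigma2"
  let ?e = "\<lambda>i. axis i 1 :: real^4"
  interpret L: linear ?L by (rule linear_linearization) simp
  have G1: "Gamma1 (?L v) = ?L (Gamma1 v)" for v
    using linearization_equivariant[OF linear_Gamma1 norm_Gamma1 _ sigma_in_S3(2)] P1 by simp
  define a b c d where "a = ?L (?e 1) $ 1" and "b = ?L (?e 2) $ 1"
    and "c = ?L (?e 1) $ 2" and "d = ?L (?e 2) $ 2"
  define m where "m = ?L (?e 3) $ 3"
  have e12: "?L (?e 1) = a *\<^sub>R ?e 1 + c *\<^sub>R ?e 2" "?L (?e 2) = b *\<^sub>R ?e 1 + d *\<^sub>R ?e 2"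
  proof -
    have "Gamma1 (?e 1) = - ?e 1" "Gamma1 (?e 2) = - ?e 2"
      by (simp_all add: Gamma1_def vec_eq_iff forall_4 vector_4 axis_def)
    then have "Gamma1 (?L (?e 1)) = - ?L (?e 1)" "Gamma1 (?L (?e 2)) = - ?L (?e 2)"
      by (simp_all add: G1 L.neg)
    then show "?L (?e 1) = a *\<^sub>R ?e 1 + c *\<^sub>R ?e 2" "?L (?e 2) = b *\<^sub>R ?e 1 + d *\<^sub>R ?e 2"
      by (simp_all add: a_def b_def c_def d_def Gamma1_def vec_eq_iff forall_4 vector_4 axis_def)
  qed
  have e3: "?L (?e 3) = m *\<^sub>R ?e 3"
    unfolding m_def by (rule linearization_axis3) simp
  have L_tangent: "?L x = (a * x$1 + b * x$2) *\<^sub>R ?e 1 + (c * x$1 + d * x$2) *\<^sub>R ?e 2 + (m * x$3) *\<^sub>R ?e 3"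
    if "x $ 4 = 0" for x
  proof -
    have x: "x = x$1 *\<^sub>R ?e 1 + x$2 *\<^sub>R ?e 2 + x$3 *\<^sub>R ?e 3"
      using that by (simp add: vec_eq_iff forall_4 axis_def)
    have "?L x = x$1 *\<^sub>R ?L (?e 1) + x$2 *\<^sub>R ?L (?e 2) + x$3 *\<^sub>R ?L (?e 3)"
      by (subst x) (simp only: L.add L.scale)
    then show ?thesis by (simp add: e12 e3 algebra_simps)
  qed
  have "Complex E2 \<omega>2 \<in> tangent_eigenvalues f sigma2" using P2_eigenvalues by simp
  then obtain u v where uv: "u $ 4 = 0" "v $ 4 = 0" "u \<noteq> 0 \<or> v \<noteq> 0"
    "?L u = E2 *\<^sub>R u - \<omega>2 *\<^sub>R v" "?L v = \<omega>2 *\<^sub>R u + E2 *\<^sub>R v"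
    by (auto simp: tangent_eigenvalues_def inner_vec_def sum_4 sigma2_def vector_4)
  have comp: "a * u$1 + b * u$2 = E2 * u$1 - \<omega>2 * v$1" "c * u$1 + d * u$2 = E2 * u$2 - \<omega>2 * v$2"
    "a * v$1 + b * v$2 = \<omega>2 * u$1 + E2 * v$1" "c * v$1 + d * v$2 = \<omega>2 * u$2 + E2 * v$2"
    "m * u$3 = E2 * u$3 - \<omega>2 * v$3" "m * v$3 = \<omega>2 * u$3 + E2 * v$3"
    using uv(4,5) unfolding L_tangent[OF uv(1)] L_tangent[OF uv(2)]
    by (simp_all add: vec_eq_iff forall_4 axis_def)
  have "\<omega>2 * ((u$3)\<^sup>2 + (v$3)\<^sup>2) = 0" using comp(5,6) by algebra
  then have "u$3 = 0" "v$3 = 0"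
    using P2_constants by (auto simp: sum_power2_eq_zero_iff)
  then have nz: "Complex (u$1) (v$1) \<noteq> 0 \<or> Complex (u$2) (v$2) \<noteq> 0"
    using uv(1-3) by (auto simp: vec_eq_iff forall_4 complex_eq_iff)
  have "(of_real a - Complex E2 \<omega>2) * (of_real d - Complex E2 \<omega>2) = of_real b * of_real c"
    using comp by (intro eigenvalue_trace_det[OF _ _ nz]) (auto simp: complex_eq_iff)
  then have det: "(a - E2) * (d - E2) - \<omega>2 * \<omega>2 = b * c"
    and tr: "\<omega>2 * (a - E2) + \<omega>2 * (d - E2) = 0"
    by (auto simp: complex_eq_iff algebra_simps)
  define n where "n = a - E2"
  have "\<omega>2 * (n + (d - E2)) = 0" using tr unfolding n_def distrib_left .
  then have nd: "d - E2 = - n" using P2_constants by simp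
  have n: "a = E2 + n" "d = E2 - n"
    using nd by (simp_all add: n_def)
  have nn: "n * n + b * c = - (\<omega>2 * \<omega>2)"
    using det[folded n_def, unfolded nd] by simp
  show ?thesis
  proof (rule convergent_off_expanding_directions[where c = "E2 * \<omega>2\<^sup>2" and
        M = "\<lambda>x. (Complex (\<omega>2 * x$1) (\<omega>2 * x$2), Complex (n * x$1 + b * x$2) (c * x$1 - n * x$2))"])
    fix p assume "Gamma1 p = - p"
    then have p: "p$3 = 0" "p$4 = 0"
      by (simp_all add: Gamma1_def vec_eq_iff forall_4 vector_4)
    have Lp: "?L p $ 1 = a * p$1 + b * p$2" "?L p $ 2 = c * p$1 + d * p$2"
      using L_tangent[OF p(2)] by (simp_all add: axis_def)
    define q1 q2 where "q1 = n * p$1 + b * p$2" and "q2 = c * p$1 - n * p$2"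
    have q: "n * q1 + b * q2 = - (\<omega>2\<^sup>2 * p$1)" "c * q1 - n * q2 = - (\<omega>2\<^sup>2 * p$2)"
      using nn unfolding q1_def q2_def power2_eq_square by algebra+
    have Lq: "?L p $ 1 = E2 * p$1 + q1" "?L p $ 2 = E2 * p$2 + q2"
      unfolding Lp n q1_def q2_def by (simp_all add: algebra_simps)
    have "n * ?L p $ 1 + b * ?L p $ 2 = E2 * q1 - \<omega>2\<^sup>2 * p$1"
      "c * ?L p $ 1 - n * ?L p $ 2 = E2 * q2 - \<omega>2\<^sup>2 * p$2"
      unfolding Lq using q by (simp_all add: q1_def q2_def algebra_simps)
    then have "(Complex (\<omega>2 * p$1) (\<omega>2 * p$2), Complex (n * p$1 + b * p$2) (c * p$1 - n * p$2)) \<bullet>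
        (Complex (\<omega>2 * ?L p $ 1) (\<omega>2 * ?L p $ 2),
          Complex (n * ?L p $ 1 + b * ?L p $ 2) (c * ?L p $ 1 - n * ?L p $ 2))
      = E2 * \<omega>2\<^sup>2 * ((p$1)\<^sup>2 + (p$2)\<^sup>2) + E2 * (q1\<^sup>2 + q2\<^sup>2)"
      by (simp add: inner_complex_def Lq q1_def[symmetric] q2_def[symmetric])
         (simp add: algebra_simps power2_eq_square)
    moreover have "(norm p)\<^sup>2 = (p$1)\<^sup>2 + (p$2)\<^sup>2"
      using p by (simp add: norm_vec_def L2_set_def sum_4)
    ultimately show "E2 * \<omega>2\<^sup>2 * (norm p)\<^sup>2 \<le>
       (Complex (\<omega>2 * p$1) (\<omega>2 * p$2), Complex (n * p$1 + b * p$2) (c * p$1 - n * p$2)) \<bullet>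
        (Complex (\<omega>2 * ?L p $ 1) (\<omega>2 * ?L p $ 2),
          Complex (n * ?L p $ 1 + b * ?L p $ 2) (c * ?L p $ 1 - n * ?L p $ 2))"
      using P2_constants by simp
  qed (use assms P1 P2_constants in
      \<open>auto simp: linear_Gamma1 Gamma1_fixed_iff Gamma1_nth complex_eq_iff zero_prod_def
         algebra_simps intro!: linearI simp del: mem_sphere\<close>)
qed

lemma off_network_not_convergent:
  assumes "P \<in> S3" "P \<notin> network \<phi>"
  shows "\<not> ((\<lambda>t. \<phi> t P) \<longlongrightarrow> sigma1) at_top" "\<not> ((\<lambda>t. \<phi> t P) \<longlongrightarrow> sigma2) at_top"
  using assms convergent_to_sigma1 convergent_to_sigma2 by (auto simp: network_eq)

end

section \<open>Reaching the wall of the first cylinder\<close>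

lemma agree_at_right_endpoint:
  fixes u v :: "real \<Rightarrow> 'a::real_normed_vector"
  assumes "continuous_on {0..1} u" "continuous_on {0..1} v"
    and "\<And>t. 0 < t \<Longrightarrow> t < 1 \<Longrightarrow> u t = v t"
  shows "u 1 = v 1"
proof -
  have "u 1 - v 1 = 0"
    by (rule continuous_constant_on_closure[where S = "{0<..<1}"])
      (use assms in \<open>auto intro!: continuous_intros\<close>)
  then show ?thesis by simp
qed

context bykov_field
begin

lemma omega_limit_invariant:
  assumes "x \<in> S3" "y \<in> omega_limit \<phi> x"
  shows "y \<in> S3" "\<phi> t y \<in> omega_limit \<phi> x"
proof -
  obtain s where s: "filterlim s at_top sequentially" "(\<lambda>n. \<phi> (s n) x) \<longlonglongrightarrow> y"
    using assms(2) by (auto simp: omega_limit_def)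
  show y: "y \<in> S3"
    by (rule closed_sequentially[OF closed_sphere _ s(2)]) (rule flow_in_S3[OF assms(1)])
  have "(\<lambda>n. \<phi> t (\<phi> (s n) x)) \<longlonglongrightarrow> \<phi> t y"
    by (rule flow_tendsto[OF _ y s(2)]) (rule flow_in_S3[OF assms(1)])
  moreover have "filterlim (\<lambda>n. t + s n) at_top sequentially"
    by (rule filterlim_tendsto_add_at_top[OF tendsto_const s(1)])
  ultimately show "\<phi> t y \<in> omega_limit \<phi> x"
    unfolding omega_limit_def by (auto simp: flow_add[OF assms(1)])
qed

text \<open>
  The accumulation points form a set of complete orbits of the network inside \<open>V\<close>. A connecting orbit
  tends to both equilibria, one in each direction of time, so it cannot stay in a closed set that
  misses one of them.
\<close>

lemma trapped_converges:
  assumes x: "x \<in> S3" "omega_limit \<phi> x \<subseteq> network \<phi>"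
    and V: "closed V" "\<And>t. t \<ge> t0 \<Longrightarrow> \<phi> t x \<in> V"
    and s: "{s, s'} = {sigma1, sigma2}" "s' \<notin> V"
  shows "((\<lambda>t. \<phi> t x) \<longlongrightarrow> s) at_top"
proof -
  have wV: "y \<in> V" if y: "y \<in> omega_limit \<phi> x" for y
  proof -
    obtain u where u: "filterlim u at_top sequentially" "(\<lambda>n. \<phi> (u n) x) \<longlonglongrightarrow> y"
      using y by (auto simp: omega_limit_def)
    have "\<forall>\<^sub>F n in sequentially. \<phi> (u n) x \<in> V"
      using u(1)[unfolded filterlim_at_top, rule_format, of t0] V(2) by (auto elim: eventually_mono)
    then show ?thesis using Lim_in_closed_set[OF V(1) _ _ u(2)] by simp
  qed
  have "y = s" if y: "y \<in> omega_limit \<phi> x" for y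
  proof -
    have orb: "\<phi> t y \<in> V" for t using omega_limit_invariant(2)[OF x(1) y] wV by blast
    have lim: "p \<noteq> s'" if "((\<lambda>t. \<phi> t y) \<longlongrightarrow> p) F" "F \<noteq> bot" for F p
      using Lim_in_closed_set[OF V(1) _ that(2,1)] orb s(2) by auto
    have "y \<in> network \<phi>" using x(2) y by blast
    then have "y = s \<or> y = s'"
    proof (cases rule: network_cases)
      case 3
      then show ?thesis using lim[OF 3(1)] lim[OF 3(2)] s(1) by (auto simp: doubleton_eq_iff)
    next
      case 4
      then show ?thesis using lim[OF 4(1)] lim[OF 4(2)] s(1) by (auto simp: doubleton_eq_iff)
    qed (use s(1) in \<open>auto simp: doubleton_eq_iff\<close>)
    then show ?thesis using wV[OF y] s(2) by auto
  qed
  then have sub: "omega_limit \<phi> x \<subseteq> {s}" by auto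
  show ?thesis
  proof (rule tendstoI)
    fix e :: real assume "e > 0"
    then have "\<forall>\<^sub>F t in at_top. \<phi> t x \<in> ball s e"
      using sub by (intro eventually_in_nbhd_of_omega_limit[OF x(1)]) auto
    then show "\<forall>\<^sub>F t in at_top. dist (\<phi> t x) s < e" by (simp add: dist_commute)
  qed
qed

text \<open>
  At the first time outside the relatively open set \<open>U\<close> the trajectory is still in the closed set \<open>V\<close>.
\<close>

lemma exit_through_boundary:
  assumes x: "x \<in> S3" and V: "closed V" "U \<subseteq> V" "openin (top_of_set S3) U"
    and t0: "\<phi> t0 x \<in> V" and t1: "t1 \<ge> t0" "\<phi> t1 x \<notin> V"
  shows "\<exists>t\<ge>t0. \<phi> t x \<in> V - U"
proof -
  obtain W where W: "open W" "U = S3 \<inter> W" using V(3) by (auto simp: openin_open)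
  have inU: "\<phi> t x \<in> U \<longleftrightarrow> \<phi> t x \<in> W" for t using W(2) flow_in_S3[OF x] by blast
  define S where "S = {t. t \<ge> t0 \<and> \<phi> t x \<notin> U}"
  have "closed ((\<lambda>t. \<phi> t x) -` (- W))"
    by (rule continuous_closed_vimage) (use W(1) flow_isCont[OF x] in auto)
  then have "closed ({t0..} \<inter> (\<lambda>t. \<phi> t x) -` (- W))" by (intro closed_Int) auto
  also have "{t0..} \<inter> (\<lambda>t. \<phi> t x) -` (- W) = S" by (auto simp: S_def inU)
  finally have "closed S" .
  moreover have "S \<noteq> {}" using t1 V(2) by (auto simp: S_def)
  moreover have bdd: "bdd_below S" by (auto simp: S_def bdd_below_def)
  ultimately have I: "Inf S \<in> S" by (intro closed_contains_Inf)
  have "\<phi> (Inf S) x \<in> V"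
  proof (cases "Inf S = t0")
    case True
    then show ?thesis using t0 by simp
  next
    case False
    then have gt: "t0 < Inf S" using I by (simp add: S_def)
    have "\<phi> t x \<in> V" if "t0 < t" "t < Inf S" for t
    proof -
      have "t \<notin> S" using cInf_lower[OF _ bdd, of t] that by auto
      then show ?thesis using that V(2) by (auto simp: S_def)
    qed
    then have "\<forall>\<^sub>F t in at_left (Inf S). \<phi> t x \<in> V"
      using eventually_at_left[OF gt] gt by blast
    moreover have "((\<lambda>t. \<phi> t x) \<longlongrightarrow> \<phi> (Inf S) x) (at_left (Inf S))"
      using flow_isCont[OF x, of "Inf S"] by (simp add: isCont_def filterlim_at_split)
    ultimately show ?thesis
      using Lim_in_closed_set[OF V(1), of "\<lambda>t. \<phi> t x" "at_left (Inf S)"] by simp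
  qed
  then show ?thesis using I by (auto simp: S_def)
qed

lemma basin_cases:
  assumes "P \<in> proper_basin \<phi>"
  shows "P \<in> S3" "P \<notin> network \<phi>" "omega_limit \<phi> P \<subseteq> network \<phi>"
  using assms by (simp_all add: proper_basin_def)

text \<open>
  Otherwise the distance to the equilibria would be bounded below, and so would its averages.
\<close>

lemma visits_nbhd_of_equilibria:
  assumes P: "P \<in> proper_basin \<phi>"
    and U: "openin (top_of_set S3) U" "sigma1 \<in> U" "sigma2 \<in> U"
  shows "\<exists>t\<ge>0. \<phi> t P \<in> U"
proof (rule ccontr)
  assume neg: "\<not> ?thesis"
  have PS: "P \<in> S3" by (rule basin_cases(1)[OF P])
  obtain d1 d2 where d: "d1 > 0" "d2 > 0" "ball sigma1 d1 \<inter> S3 \<subseteq> U" "ball sigma2 d2 \<inter> S3 \<subseteq> U"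
    using U unfolding openin_contains_ball by blast
  define d where "d = min d1 d2"
  have far: "d \<le> eq_dist (\<phi> t P)" if "t \<ge> 0" for t
  proof -
    have "\<phi> t P \<notin> U" using neg that by auto
    then have "\<phi> t P \<notin> ball sigma1 d1" "\<phi> t P \<notin> ball sigma2 d2"
      using d(3,4) flow_in_S3[OF PS] by blast+
    then have "d1 \<le> dist (\<phi> t P) sigma1" "d2 \<le> dist (\<phi> t P) sigma2"
      by (auto simp: dist_commute)
    moreover obtain s where "s \<in> {sigma1, sigma2}" "eq_dist (\<phi> t P) = dist (\<phi> t P) s"
      using infdist_attains_inf[of "{sigma1, sigma2}" "\<phi> t P"] by auto
    ultimately show ?thesis by (auto simp: d_def)
  qed
  have "\<forall>\<^sub>F t in at_top. integral {0..t} (\<lambda>s. eq_dist (\<phi> s P)) / t < d"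
    using eq_dist_average_tendsto_0[OF basin_cases(1,3)[OF P]] d(1,2)
    by (intro order_tendstoD(2)[where y = 0]) (auto simp: d_def)
  moreover have "\<forall>\<^sub>F t::real in at_top. t > 0" by (rule eventually_gt_at_top)
  ultimately have "\<forall>\<^sub>F t::real in at_top. False"
  proof eventually_elim
    case (elim t)
    have "integral {0..t} (\<lambda>_. d) \<le> integral {0..t} (\<lambda>s. eq_dist (\<phi> s P))"
      using far flow_eq_dist_continuous[OF PS]
      by (intro integral_le integrable_continuous_real) auto
    then show ?case using elim by (simp add: field_simps)
  qed
  then show False by simp
qed

lemma basin_flow:
  assumes "P \<in> proper_basin \<phi>"
  shows "\<phi> t P \<in> proper_basin \<phi>"
proof -
  note P = basin_cases[OF assms]
  have "y \<in> omega_limit \<phi> P" if y: "y \<in> omega_limit \<phi> (\<phi> t P)" for y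
  proof -
    obtain s where s: "filterlim s at_top sequentially" "(\<lambda>n. \<phi> (s n) (\<phi> t P)) \<longlonglongrightarrow> y"
      using y by (auto simp: omega_limit_def)
    have "filterlim (\<lambda>n. t + s n) at_top sequentially"
      by (rule filterlim_tendsto_add_at_top[OF tendsto_const s(1)])
    then show ?thesis
      using s(2) unfolding omega_limit_def flow_add[OF P(1)] by (auto simp: add.commute)
  qed
  then show ?thesis
    using P flow_in_S3[OF P(1)] flow_in_network_iff[OF P(1)] by (auto simp: proper_basin_def)
qed

lemma basin_Gamma2:
  assumes "P \<in> proper_basin \<phi>"
  shows "Gamma2 P \<in> proper_basin \<phi>"
proof -
  note P = basin_cases[OF assms]
  have bl: "bounded_linear Gamma2" using linear_Gamma2 by (simp add: linear_conv_bounded_linear)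
  have "y \<in> network \<phi>" if y: "y \<in> omega_limit \<phi> (Gamma2 P)" for y
  proof -
    obtain s where s: "filterlim s at_top sequentially" "(\<lambda>n. Gamma2 (\<phi> (s n) P)) \<longlonglongrightarrow> y"
      using y unfolding omega_limit_def flow_Gamma2[OF P(1)] by auto
    from bounded_linear.tendsto[OF bl s(2)] have "Gamma2 y \<in> omega_limit \<phi> P"
      using s(1) unfolding omega_limit_def by auto
    then show ?thesis using P(3) Gamma2_in_network_iff by blast
  qed
  then show ?thesis
    using P Gamma2_in_network_iff by (auto simp: proper_basin_def)
qed

end

lemma cylinder_chartD:
  assumes "cylinder_chart f s l m \<psi>"
  shows "\<psi> (0, 0) = s" "continuous_on cyl \<psi>" "\<psi> ` cyl \<subseteq> S3" "openin (top_of_set S3) (\<psi> ` open_cyl)"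
    and "\<And>w z. (w, z) \<in> cyl \<Longrightarrow> Gamma2 (\<psi> (w, z)) = \<psi> (w, - z)"
    and "\<And>w z. (w, z) \<in> cyl \<Longrightarrow> \<psi> (w, z) \<in> Fix Gamma1 \<longleftrightarrow> w = 0"
    and "\<And>w z. (w, z) \<in> cyl \<Longrightarrow> \<psi> (w, z) \<in> Fix Gamma2 \<longleftrightarrow> z = 0"
proof -
  note chart = assms[unfolded cylinder_chart_def]
  show "\<psi> (0, 0) = s" using chart by (elim conjE)
  show "continuous_on cyl \<psi>" using chart by (elim conjE)
  show "\<psi> ` cyl \<subseteq> S3" using chart by (elim conjE)
  show "openin (top_of_set S3) (\<psi> ` open_cyl)" using chart by (elim conjE)
  have all: "\<forall>(w, z)\<in>cyl. Gamma2 (\<psi> (w, z)) = \<psi> (w, - z) \<and>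
        (\<psi> (w, z) \<in> Fix Gamma1 \<longleftrightarrow> w = 0) \<and> (\<psi> (w, z) \<in> Fix Gamma2 \<longleftrightarrow> z = 0)"
    using chart by (elim conjE)
  have *: "Gamma2 (\<psi> (w, z)) = \<psi> (w, - z) \<and>
        (\<psi> (w, z) \<in> Fix Gamma1 \<longleftrightarrow> w = 0) \<and> (\<psi> (w, z) \<in> Fix Gamma2 \<longleftrightarrow> z = 0)"
    if "(w, z) \<in> cyl" for w z
    using bspec[OF all that] by simp
  show "Gamma2 (\<psi> (w, z)) = \<psi> (w, - z)" "\<psi> (w, z) \<in> Fix Gamma1 \<longleftrightarrow> w = 0"
    "\<psi> (w, z) \<in> Fix Gamma2 \<longleftrightarrow> z = 0" if "(w, z) \<in> cyl" for w z
    using *[OF that] by simp_all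
qed

lemma cyl_iff: "(w, z) \<in> cyl \<longleftrightarrow> cmod w \<le> 1 \<and> \<bar>z\<bar> \<le> 1"
  by (auto simp: cyl_def)

lemma open_cyl_iff: "(w, z) \<in> open_cyl \<longleftrightarrow> cmod w < 1 \<and> \<bar>z\<bar> < 1"
  by (auto simp: open_cyl_def)

lemma cylinder_chart_closed:
  assumes "cylinder_chart f s l m \<psi>"
  shows "compact (\<psi> ` cyl)" "closed (\<psi> ` cyl)" "\<psi> ` open_cyl \<subseteq> \<psi> ` cyl" "s \<in> \<psi> ` open_cyl"
proof -
  have "compact cyl" unfolding cyl_def by (intro compact_Times) auto
  then show "compact (\<psi> ` cyl)"
    using cylinder_chartD(2)[OF assms] by (intro compact_continuous_image)
  then show "closed (\<psi> ` cyl)" by (rule compact_imp_closed)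
  show "\<psi> ` open_cyl \<subseteq> \<psi> ` cyl" by (intro image_mono) (auto simp: open_cyl_def cyl_def)
  have "(0, 0) \<in> open_cyl" by (simp add: open_cyl_iff)
  then show "s \<in> \<psi> ` open_cyl" using cylinder_chartD(1)[OF assms] by force
qed

context bykov_coordinates
begin

text \<open>
  The sections through which trajectories with \<open>z > 0\<close> enter the two cylinders. The centre of the top
  disc is left out, since it lies on a one-dimensional connection.
\<close>

definition In_sigma1 :: "(real^4) set" where
  "In_sigma1 = {\<psi>1 (rcis 1 \<theta>, z) |\<theta> z. 0 < z \<and> z < 1}"

definition In_sigma2 :: "(real^4) set" where
  "In_sigma2 = {\<psi>2 (rcis \<rho> \<theta>, 1) |\<theta> \<rho>. 0 < \<rho> \<and> \<rho> < 1}"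

lemma sigma_not_in_other_cylinder: "sigma2 \<notin> \<psi>1 ` cyl" "sigma1 \<notin> \<psi>2 ` cyl"
  using disjoint cylinder_chart_closed(4)[OF chart1] cylinder_chart_closed(4)[OF chart2] by blast+

text \<open>
  The gluing of the two cylinders extends by continuity to the rims, and identifies them with parts
  of the circle at height \<open>a\<close> on the wall of the first cylinder. A trajectory through a rim thus also
  passes through \<open>In_sigma1\<close>.
\<close>

lemma rim_eq_wall:
  "\<psi>1 (rcis 1 \<theta>, 1) = \<psi>1 (rcis 1 (h \<theta>), a)" "\<psi>2 (rcis 1 \<theta>, 1) = \<psi>1 (rcis 1 (h \<theta>), a)"
proof -
  note c1 = cylinder_chartD(2)[OF chart1] and c2 = cylinder_chartD(2)[OF chart2]
  have radial: "continuous_on {0..1} (\<lambda>\<rho>. (rcis \<rho> \<theta>, 1::real))" for \<theta>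
    unfolding rcis_def
    by (intro continuous_on_Pair continuous_on_mult continuous_on_of_real continuous_on_id continuous_on_const)
  have wall: "continuous_on {0..1} (\<lambda>z. (rcis 1 \<theta>, c * z))" for \<theta> and c :: real
    by (intro continuous_on_Pair continuous_on_mult continuous_on_id continuous_on_const)
  have "continuous_on {0..1} (\<lambda>\<rho>. \<psi>1 (rcis \<rho> \<theta>, 1))" "continuous_on {0..1} (\<lambda>\<rho>. \<psi>2 (rcis \<rho> \<theta>, 1))"
    by (rule continuous_on_compose2[OF c1 radial] continuous_on_compose2[OF c2 radial];
        auto simp: cyl_iff)+
  then have "\<psi>1 (rcis 1 \<theta>, 1) = \<psi>2 (rcis 1 \<theta>, 1)"
    by (rule agree_at_right_endpoint) (use transition12 in simp)
  moreover have "continuous_on {0..1} (\<lambda>z. \<psi>2 (rcis 1 \<theta>, 1 * z))"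
    by (rule continuous_on_compose2[OF c2 wall]) (auto simp: cyl_iff)
  then have "\<psi>2 (rcis 1 \<theta>, 1 * 1) = \<psi>1 (rcis 1 (h \<theta>), a * 1)"
  proof (rule agree_at_right_endpoint[of "\<lambda>z. \<psi>2 (rcis 1 \<theta>, 1 * z)" "\<lambda>z. \<psi>1 (rcis 1 (h \<theta>), a * z)"])
    show "continuous_on {0..1} (\<lambda>z. \<psi>1 (rcis 1 (h \<theta>), a * z))"
      by (rule continuous_on_compose2[OF c1 wall])
        (use a_range in \<open>auto simp: cyl_iff mult_le_one abs_mult\<close>)
  qed (use transition21 in simp)
  ultimately show "\<psi>1 (rcis 1 \<theta>, 1) = \<psi>1 (rcis 1 (h \<theta>), a)" "\<psi>2 (rcis 1 \<theta>, 1) = \<psi>1 (rcis 1 (h \<theta>), a)"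
    by simp_all
qed

lemma upper_boundary_in_sections:
  assumes "cmod w \<le> 1" "w \<noteq> 0" "0 < z" "z \<le> 1" "cmod w = 1 \<or> z = 1"
  shows "\<psi>1 (w, z) \<in> In_sigma1 \<union> In_sigma2" "\<psi>2 (w, z) \<in> In_sigma1 \<union> In_sigma2"
proof -
  have wall: "\<psi>1 (rcis 1 \<theta>, y) \<in> In_sigma1" if "0 < y" "y < 1" for \<theta> y
    using that unfolding In_sigma1_def by blast
  have top: "\<psi>2 (w, 1) \<in> In_sigma2" "\<psi>1 (w, 1) \<in> In_sigma2" if "cmod w < 1"
  proof -
    have "\<psi>2 (rcis (cmod w) (Arg w), 1) \<in> In_sigma2"
      unfolding In_sigma2_def using that assms(2)
      by (intro CollectI exI[of _ "Arg w"] exI[of _ "cmod w"]) simp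
    then show "\<psi>2 (w, 1) \<in> In_sigma2" by (simp add: rcis_cmod_Arg)
    moreover have "\<psi>1 (rcis (cmod w) (Arg w), 1) = \<psi>2 (rcis (cmod w) (Arg w), 1)"
      using transition12 that by simp
    ultimately show "\<psi>1 (w, 1) \<in> In_sigma2" by (simp add: rcis_cmod_Arg)
  qed
  have w: "w = rcis 1 (Arg w)" if "cmod w = 1" using rcis_cmod_Arg[of w] that by simp
  show "\<psi>1 (w, z) \<in> In_sigma1 \<union> In_sigma2"
  proof (cases "cmod w = 1")
    case True
    then show ?thesis
      using wall[of z "Arg w"] wall[of a "h (Arg w)"] rim_eq_wall(1)[of "Arg w"] w assms a_range
      by (cases "z = 1") auto
  qed (use assms top in auto)
  show "\<psi>2 (w, z) \<in> In_sigma1 \<union> In_sigma2"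
  proof (cases "cmod w = 1")
    case True
    have "\<psi>2 (rcis 1 (Arg w), z) = \<psi>1 (rcis 1 (h (Arg w)), a * z)"
      using rim_eq_wall(2)[of "Arg w"] transition21 assms by (cases "z = 1") auto
    moreover have "a * z \<le> a" using a_range assms by (intro mult_left_le) auto
    then have "a * z < 1" using a_range(2) by (rule order_le_less_trans)
    moreover have "0 < a * z" using a_range assms by simp
    ultimately show ?thesis using wall[of "a * z"] w[OF True] by auto
  qed (use assms top in auto)
qed

text \<open>
  The reflection \<open>Gamma2\<close> reduces the lower half of the boundary to the upper half.
\<close>

lemma boundary_in_sections:
  assumes chart: "cylinder_chart f s l m \<psi>"
    and upper: "\<And>w z. \<lbrakk>cmod w \<le> 1; w \<noteq> 0; 0 < z; z \<le> 1; cmod w = 1 \<or> z = 1\<rbrakk> \<Longrightarrow> \<psi> (w, z) \<in> In_sigma1 \<union> In_sigma2"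
    and x: "x \<in> \<psi> ` cyl - \<psi> ` open_cyl" "x \<notin> network \<phi>"
  shows "x \<in> In_sigma1 \<union> In_sigma2 \<or> Gamma2 x \<in> In_sigma1 \<union> In_sigma2"
proof -
  obtain w z where q: "x = \<psi> (w, z)" "(w, z) \<in> cyl" "(w, z) \<notin> open_cyl"
    using x(1) by (force simp: image_iff)
  then have "w \<noteq> 0" "z \<noteq> 0"
    using cylinder_chartD(6,7)[OF chart q(2)] x(2) by (auto simp: network_eq)
  moreover have "cmod w \<le> 1" "\<bar>z\<bar> \<le> 1" "cmod w = 1 \<or> \<bar>z\<bar> = 1"
    using q(2,3) by (auto simp: cyl_iff open_cyl_iff)
  ultimately have "\<psi> (w, \<bar>z\<bar>) \<in> In_sigma1 \<union> In_sigma2" by (intro upper) auto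
  then show ?thesis
    using q(1) cylinder_chartD(5)[OF chart q(2)] by (cases "z \<ge> 0") auto
qed

text \<open>
  A trajectory that stayed in the cylinder would converge to an equilibrium, which is impossible off
  the network.
\<close>

lemma leaves_cylinder:
  assumes chart: "cylinder_chart f s l m \<psi>" and s: "{s, s'} = {sigma1, sigma2}" "s' \<notin> \<psi> ` cyl"
    and upper: "\<And>w z. \<lbrakk>cmod w \<le> 1; w \<noteq> 0; 0 < z; z \<le> 1; cmod w = 1 \<or> z = 1\<rbrakk> \<Longrightarrow> \<psi> (w, z) \<in> In_sigma1 \<union> In_sigma2"
    and P: "P \<in> proper_basin \<phi>" and t0: "\<phi> t0 P \<in> \<psi> ` cyl"
  shows "\<exists>t\<ge>t0. \<phi> t P \<in> In_sigma1 \<union> In_sigma2 \<or> Gamma2 (\<phi> t P) \<in> In_sigma1 \<union> In_sigma2"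
proof -
  note P = basin_cases[OF P]
  note cl = cylinder_chart_closed[OF chart]
  have "\<exists>t1\<ge>t0. \<phi> t1 P \<notin> \<psi> ` cyl"
  proof (rule ccontr)
    assume "\<not> ?thesis"
    then have "((\<lambda>t. \<phi> t P) \<longlongrightarrow> s) at_top"
      by (intro trapped_converges[OF P(1,3) cl(2) _ s]) auto
    then show False using off_network_not_convergent[OF P(1,2)] s(1) by (auto simp: doubleton_eq_iff)
  qed
  then obtain t where "t \<ge> t0" "\<phi> t P \<in> \<psi> ` cyl - \<psi> ` open_cyl"
    using exit_through_boundary[OF P(1) cl(2,3) cylinder_chartD(4)[OF chart] t0] by blast
  moreover have "\<phi> t P \<notin> network \<phi>" using flow_in_network_iff P by blast
  ultimately show ?thesis using boundary_in_sections[OF chart upper] by blast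
qed

lemma In_sigma2_to_In_sigma1:
  assumes "x \<in> In_sigma2"
  shows "\<exists>t\<ge>0. \<phi> t x \<in> In_sigma1"
proof -
  obtain \<theta> \<rho> where x: "x = \<psi>2 (rcis \<rho> \<theta>, 1)" "0 < \<rho>" "\<rho> < 1"
    using assms unfolding In_sigma2_def by blast
  let ?z = "\<rho> powr (C2 / E2) + T2 (\<theta>, \<rho>)" and ?\<beta> = "- (\<omega>2 / E2) * ln \<rho> + \<theta> + T1 (\<theta>, \<rho>)"
  let ?t = "- (1 / E2) * ln \<rho>"
  have z: "0 < ?z" "?z < 1" and ex: "\<phi> ?t x = \<psi>2 (rcis 1 ?\<beta>, ?z)"
    using passage2 x by (auto simp: passage_def)
  have "\<phi> ?t x = \<psi>1 (rcis 1 (h ?\<beta>), a * ?z)"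
    using ex transition21 z by simp
  moreover have "0 < a * ?z" "a * ?z < 1"
    using z a_range mult_strict_mono[of a 1 ?z 1] by auto
  ultimately have "\<phi> ?t x \<in> In_sigma1" unfolding In_sigma1_def by blast
  moreover have "?t \<ge> 0" using x P2_constants by (simp add: mult_nonneg_nonpos field_simps)
  ultimately show ?thesis by blast
qed

lemma reaches_In_sigma1:
  assumes P: "P \<in> proper_basin \<phi>"
  shows "\<exists>t\<ge>0. \<phi> t P \<in> In_sigma1 \<or> Gamma2 (\<phi> t P) \<in> In_sigma1"
proof -
  note PS = basin_cases(1)[OF P]
  have "openin (top_of_set S3) (\<psi>1 ` open_cyl \<union> \<psi>2 ` open_cyl)"
    using cylinder_chartD(4)[OF chart1] cylinder_chartD(4)[OF chart2] by blast
  then obtain t0 where t0: "t0 \<ge> 0" "\<phi> t0 P \<in> \<psi>1 ` open_cyl \<union> \<psi>2 ` open_cyl"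
    using visits_nbhd_of_equilibria[OF P] cylinder_chart_closed(4)[OF chart1]
      cylinder_chart_closed(4)[OF chart2] by blast
  have "\<exists>t\<ge>t0. \<phi> t P \<in> In_sigma1 \<union> In_sigma2 \<or> Gamma2 (\<phi> t P) \<in> In_sigma1 \<union> In_sigma2"
  proof (cases "\<phi> t0 P \<in> \<psi>1 ` cyl")
    case True
    show ?thesis
      by (rule leaves_cylinder[OF chart1 refl sigma_not_in_other_cylinder(1) _ P True])
        (rule upper_boundary_in_sections(1))
  next
    case False
    then have "\<phi> t0 P \<in> \<psi>2 ` cyl"
      using t0(2) cylinder_chart_closed(3)[OF chart1] cylinder_chart_closed(3)[OF chart2] by blast
    from leaves_cylinder[OF chart2 insert_commute sigma_not_in_other_cylinder(2) _ P this]
    show ?thesis by this (rule upper_boundary_in_sections(2))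
  qed
  then obtain t where tt: "t \<ge> t0" and t2: "\<phi> t P \<in> In_sigma1 \<union> In_sigma2 \<or> Gamma2 (\<phi> t P) \<in> In_sigma1 \<union> In_sigma2"
    by blast
  have t: "t \<ge> 0" using tt t0(1) by simp
  consider "\<phi> t P \<in> In_sigma1 \<or> Gamma2 (\<phi> t P) \<in> In_sigma1" | "\<phi> t P \<in> In_sigma2" | "Gamma2 (\<phi> t P) \<in> In_sigma2"
    using t2 by auto
  then show ?thesis
  proof cases
    case 1
    then show ?thesis using t by blast
  next
    case 2
    obtain u where "u \<ge> 0" "\<phi> u (\<phi> t P) \<in> In_sigma1" using In_sigma2_to_In_sigma1[OF 2] by blast
    then show ?thesis using t by (intro exI[of _ "u + t"]) (simp add: flow_add[OF PS])
  next
    case 3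
    obtain u where "u \<ge> 0" "\<phi> u (Gamma2 (\<phi> t P)) \<in> In_sigma1" using In_sigma2_to_In_sigma1[OF 3] by blast
    then show ?thesis using t
      by (intro exI[of _ "u + t"]) (simp add: flow_add[OF PS] flow_Gamma2[OF flow_in_S3[OF PS]])
  qed
qed

end

section \<open>Limits of ratios and of weighted averages\<close>

text \<open>
  The theorem of Stolz and Cesaro. From some index on, \<open>s k\<close> differs from \<open>c * t k\<close> by at most
  \<open>e / 2 * t k\<close>; the earlier terms are negligible against the divergent denominator.
\<close>

lemma stolz_cesaro_ratio:
  fixes s t :: "nat \<Rightarrow> real"
  assumes t: "\<And>k. t k > 0" "filterlim (\<lambda>n. \<Sum>k<n. t k) at_top sequentially"
    and lim: "(\<lambda>k. s k / t k) \<longlonglongrightarrow> c"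
  shows "(\<lambda>n. (\<Sum>k<n. s k) / (\<Sum>k<n. t k)) \<longlonglongrightarrow> c"
proof (rule tendstoI)
  fix e :: real assume "e > 0"
  then have "\<forall>\<^sub>F k in sequentially. dist (s k / t k) c < e / 2"
    using lim by (intro tendstoD) auto
  then obtain N where N: "\<And>k. k \<ge> N \<Longrightarrow> \<bar>s k / t k - c\<bar> < e / 2"
    unfolding eventually_sequentially dist_real_def by blast
  define b where "b k = (if k < N then \<bar>s k - c * t k\<bar> else 0)" for k
  define B where "B = (\<Sum>k<N. b k)"
  have summand: "\<bar>s k - c * t k\<bar> \<le> b k + e / 2 * t k" for k
  proof (cases "k < N")
    case True
    then show ?thesis using t(1)[of k] \<open>e > 0\<close> by (simp add: b_def)
  next
    case False
    have "s k - c * t k = (s k / t k - c) * t k" using t(1)[of k] by (simp add: field_simps)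
    then have "\<bar>s k - c * t k\<bar> = \<bar>s k / t k - c\<bar> * t k" using t(1)[of k] by (simp add: abs_mult)
    also have "\<dots> \<le> e / 2 * t k"
      using N[of k] False t(1)[of k] by (intro mult_right_mono) auto
    finally show ?thesis using False by (simp add: b_def)
  qed
  have "\<forall>\<^sub>F n in sequentially. (\<Sum>k<n. t k) > max 0 (2 * B / e)"
    using t(2) unfolding filterlim_at_top_dense by blast
  moreover have "\<forall>\<^sub>F n in sequentially. n \<ge> N" by (rule eventually_ge_at_top)
  ultimately show "\<forall>\<^sub>F n in sequentially. dist ((\<Sum>k<n. s k) / (\<Sum>k<n. t k)) c < e"
  proof eventually_elim
    case (elim n)
    let ?T = "\<Sum>k<n. t k"
    have T: "?T > 0" "2 * B / e < ?T" using elim(1) by simp_all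
    have "\<bar>(\<Sum>k<n. s k) - c * ?T\<bar> = \<bar>\<Sum>k<n. s k - c * t k\<bar>"
      by (simp add: sum_subtractf sum_distrib_left)
    also have "\<dots> \<le> (\<Sum>k<n. b k + e / 2 * t k)"
      by (rule order_trans[OF sum_abs sum_mono]) (rule summand)
    also have "\<dots> = (\<Sum>k<n. b k) + e / 2 * ?T"
      by (simp add: sum.distrib sum_distrib_left)
    also have "(\<Sum>k<n. b k) = B"
      unfolding B_def using elim(2) by (intro sum.mono_neutral_right) (auto simp: b_def)
    also have "B + e / 2 * ?T < e * ?T" using T \<open>e > 0\<close> by (simp add: field_simps)
    finally have "\<bar>(\<Sum>k<n. s k) - c * ?T\<bar> < e * ?T" .
    moreover have "(\<Sum>k<n. s k) / ?T - c = ((\<Sum>k<n. s k) - c * ?T) / ?T"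
      using T(1) by (simp add: field_simps)
    ultimately show ?case using T(1) by (simp add: dist_real_def abs_divide field_simps)
  qed
qed

lemma small_remainder_bound:
  assumes "small_remainder p R"
  shows "\<exists>K. \<forall>\<^sub>F y in at_right 0. \<forall>\<theta>. \<bar>R (\<theta>, y)\<bar> \<le> K * y powr p"
proof -
  have "iterated_partial [] R \<in> O[top \<times>\<^sub>F at_right 0](\<lambda>(\<theta>, y). y powr p)"
    using assms unfolding small_remainder_def by (metis empty_set empty_subsetI)
  then obtain K where "\<forall>\<^sub>F x in top \<times>\<^sub>F at_right 0. norm (R x) \<le> K * norm (case x of (\<theta>, y) \<Rightarrow> y powr p)"
    by (auto elim: landau_o.bigE)
  then obtain Q where Q: "eventually Q (at_right 0)" "\<And>\<theta> y. Q y \<Longrightarrow> \<bar>R (\<theta>, y)\<bar> \<le> K * y powr p"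
    unfolding eventually_prod_filter eventually_top by auto
  from Q(1) have "\<forall>\<^sub>F y in at_right 0. \<forall>\<theta>. \<bar>R (\<theta>, y)\<bar> \<le> K * y powr p"
    by (rule eventually_mono) (blast intro: Q(2))
  then show ?thesis ..
qed

text \<open>
  The perturbed power is \<open>c * z powr \<delta> * (1 + q)\<close> with \<open>q\<close> tending to \<open>0\<close>. In its logarithm the terms
  \<open>ln c\<close> and \<open>ln (1 + q)\<close> remain bounded, while \<open>ln z\<close> tends to \<open>- \<infinity>\<close>.
\<close>

lemma log_ratio_of_perturbed_power:
  fixes z r \<theta> :: "nat \<Rightarrow> real"
  assumes R: "small_remainder p R" and p: "0 < \<delta>" "\<delta> < p" and "c > 0"
    and z: "\<And>k. 0 < z k" "z \<longlonglongrightarrow> 0"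
    and r: "\<And>k. r k = c * (z k powr \<delta> + R (\<theta> k, z k))"
  shows "(\<lambda>k. ln (r k) / ln (z k)) \<longlonglongrightarrow> \<delta>" "r \<longlonglongrightarrow> 0"
proof -
  define q where "q k = R (\<theta> k, z k) / z k powr \<delta>" for k
  have r': "r k = c * (z k powr \<delta> * (1 + q k))" for k
    using z(1)[of k] by (simp add: r q_def field_simps)
  have z0: "filterlim z (at_right 0) sequentially"
    using z by (simp add: filterlim_at less_imp_neq[OF z(1), symmetric])
  obtain K where K: "\<forall>\<^sub>F y in at_right 0. \<forall>\<theta>. \<bar>R (\<theta>, y)\<bar> \<le> K * y powr p"
    using small_remainder_bound[OF R] by blast
  have "\<forall>\<^sub>F k in sequentially. \<forall>\<theta>. \<bar>R (\<theta>, z k)\<bar> \<le> K * z k powr p"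
    using z0 K unfolding filterlim_iff by blast
  then have "\<forall>\<^sub>F k in sequentially. norm (q k) \<le> K * z k powr (p - \<delta>)"
  proof eventually_elim
    case (elim k)
    have "\<bar>q k\<bar> = \<bar>R (\<theta> k, z k)\<bar> / z k powr \<delta>" by (simp add: q_def)
    also have "\<dots> \<le> (K * z k powr p) / z k powr \<delta>"
      using elim by (intro divide_right_mono) auto
    also have "\<dots> = K * z k powr (p - \<delta>)" using z(1)[of k] by (simp add: powr_diff)
    finally show ?case by simp
  qed
  moreover have pow0: "(\<lambda>k. z k powr d) \<longlonglongrightarrow> 0" if "d > 0" for d
    by (rule tendsto_zero_powrI[OF z(2) tendsto_const _ that]) (simp add: less_imp_le[OF z(1)])
  have "(\<lambda>k. K * z k powr (p - \<delta>)) \<longlonglongrightarrow> 0"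
    using tendsto_mult_right_zero[OF pow0[of "p - \<delta>"]] p by simp
  ultimately have q: "q \<longlonglongrightarrow> 0" by (rule Lim_null_comparison)
  have "(\<lambda>k. c * (z k powr \<delta> * (1 + q k))) \<longlonglongrightarrow> c * (0 * (1 + 0))"
    by (intro tendsto_intros pow0 p(1) q)
  then show "r \<longlonglongrightarrow> 0" unfolding r'[symmetric] by simp
  have lnz: "filterlim (\<lambda>k. ln (z k)) at_bot sequentially"
    by (rule filterlim_compose[OF ln_at_0 z0])
  then have inf: "filterlim (\<lambda>k. ln (z k)) at_infinity sequentially"
    by (rule filterlim_at_bot_imp_at_infinity)
  have "(\<lambda>k. ln (1 + q k)) \<longlonglongrightarrow> ln (1 + 0)"
    by (intro tendsto_intros q) auto
  then have "(\<lambda>k. ln c / ln (z k) + \<delta> + ln (1 + q k) / ln (z k)) \<longlonglongrightarrow> 0 + \<delta> + 0"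
    by (rule tendsto_add[OF tendsto_add[OF tendsto_divide_0[OF tendsto_const inf] tendsto_const]
          tendsto_divide_0[OF _ inf]])
  moreover have "\<forall>\<^sub>F k in sequentially. ln (r k) / ln (z k) = ln c / ln (z k) + \<delta> + ln (1 + q k) / ln (z k)"
  proof -
    have "\<forall>\<^sub>F k in sequentially. q k > - 1" using q by (intro order_tendstoD) auto
    moreover have "\<forall>\<^sub>F k in sequentially. ln (z k) < 0"
      using lnz by (simp add: filterlim_at_bot_dense)
    ultimately show ?thesis
    proof eventually_elim
      case (elim k)
      have "ln (r k) = ln c + (\<delta> * ln (z k) + ln (1 + q k))"
        using elim z(1)[of k] \<open>c > 0\<close> by (simp add: r' ln_mult ln_powr)
      then show ?case using elim by (simp add: field_simps)
    qed
  qed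
  ultimately show "(\<lambda>k. ln (r k) / ln (z k)) \<longlonglongrightarrow> \<delta>"
    by (subst tendsto_cong) simp_all
qed

text \<open>
  In the application, \<open>A\<close> and \<open>B\<close> are the times spent near two equilibria at which the observable has
  the values \<open>p\<close> and \<open>q\<close>, \<open>I\<close> is the integral of the observable, and \<open>D\<close> is the integral of the distance
  to the equilibria.
\<close>

lemma weighted_average_limit:
  fixes A B I D :: "nat \<Rightarrow> real"
  assumes A: "filterlim A at_top sequentially" and BA: "(\<lambda>n. B n / A n) \<longlonglongrightarrow> g" "g > 0"
    and D: "(\<lambda>n. D n / (A n + B n)) \<longlonglongrightarrow> 0"
    and err: "\<And>e. e > 0 \<Longrightarrow> \<exists>M. \<forall>n. \<bar>I n - (p * A n + q * B n)\<bar> \<le> e * (A n + B n) + M * D n"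
  shows "(\<lambda>n. I n / (A n + B n)) \<longlonglongrightarrow> 1 / (1 + g) * p + g / (1 + g) * q"
proof -
  have pos: "\<forall>\<^sub>F n in sequentially. A n > 0 \<and> A n + B n > 0"
  proof -
    have "\<forall>\<^sub>F n in sequentially. A n > 0" using A by (simp add: filterlim_at_top_dense)
    moreover have "\<forall>\<^sub>F n in sequentially. B n / A n > 0" using BA by (intro order_tendstoD)
    ultimately show ?thesis by eventually_elim (auto simp: zero_less_divide_iff)
  qed
  have "(\<lambda>n. 1 / (1 + B n / A n) * p + (B n / A n) / (1 + B n / A n) * q)
      \<longlonglongrightarrow> 1 / (1 + g) * p + g / (1 + g) * q"
    using BA(2) by (intro tendsto_intros BA(1)) auto
  moreover have "(\<lambda>n. (I n - (p * A n + q * B n)) / (A n + B n)) \<longlonglongrightarrow> 0"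
  proof (rule tendstoI)
    fix e :: real assume "e > 0"
    then obtain M where M: "\<And>n. \<bar>I n - (p * A n + q * B n)\<bar> \<le> e / 2 * (A n + B n) + M * D n"
      using err[of "e / 2"] by auto
    have "(\<lambda>n. M * (D n / (A n + B n))) \<longlonglongrightarrow> 0" by (rule tendsto_mult_right_zero[OF D])
    then have "\<forall>\<^sub>F n in sequentially. M * (D n / (A n + B n)) < e / 2"
      using \<open>e > 0\<close> by (intro order_tendstoD) auto
    then show "\<forall>\<^sub>F n in sequentially. dist ((I n - (p * A n + q * B n)) / (A n + B n)) 0 < e"
      using pos
    proof eventually_elim
      case (elim n)
      have "\<bar>(I n - (p * A n + q * B n)) / (A n + B n)\<bar> = \<bar>I n - (p * A n + q * B n)\<bar> / (A n + B n)"
        using elim by (simp add: abs_divide)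
      also have "\<dots> \<le> (e / 2 * (A n + B n) + M * D n) / (A n + B n)"
        using elim M by (intro divide_right_mono) auto
      also have "\<dots> = e / 2 + M * (D n / (A n + B n))"
      proof -
        have "e / 2 * (A n + B n) / (A n + B n) = e / 2" using elim by (intro nonzero_mult_div_cancel_right) auto
        then show ?thesis by (simp only: add_divide_distrib times_divide_eq_right)
      qed
      also have "\<dots> < e" using elim(1) by linarith
      finally show ?case by (simp add: dist_real_def)
    qed
  qed
  ultimately have "(\<lambda>n. (1 / (1 + B n / A n) * p + (B n / A n) / (1 + B n / A n) * q)
      + (I n - (p * A n + q * B n)) / (A n + B n)) \<longlonglongrightarrow> (1 / (1 + g) * p + g / (1 + g) * q) + 0"
    by (rule tendsto_add)
  moreover have "\<forall>\<^sub>F n in sequentially. I n / (A n + B n) =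
      (1 / (1 + B n / A n) * p + (B n / A n) / (1 + B n / A n) * q)
      + (I n - (p * A n + q * B n)) / (A n + B n)"
    using pos
  proof eventually_elim
    case (elim n)
    define b where "b = B n / A n"
    have B: "B n = b * A n" using elim by (simp add: b_def)
    have "(p * A n + q * B n) / (A n + B n) = ((p + q * b) * A n) / ((1 + b) * A n)"
      by (simp add: B algebra_simps)
    also have "\<dots> = (p + q * b) / (1 + b)" using elim by simp
    also have "\<dots> = 1 / (1 + b) * p + b / (1 + b) * q"
      by (simp add: add_divide_distrib mult.commute)
    finally have "1 / (1 + B n / A n) * p + (B n / A n) / (1 + B n / A n) * q = (p * A n + q * B n) / (A n + B n)"
      by (simp only: b_def)
    then show ?case using elim by (simp add: diff_divide_distrib)
  qed
  ultimately show ?thesis by (subst tendsto_cong) simp_all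
qed

lemma filterlim_at_top_interleave:
  fixes u v :: "nat \<Rightarrow> real"
  assumes "filterlim u at_top sequentially" "filterlim v at_top sequentially"
  shows "filterlim (\<lambda>n. if even n then u (n div 2) else v (n div 2)) at_top sequentially"
  unfolding filterlim_at_top
proof
  fix Z :: real
  obtain N M where N: "\<And>n. n \<ge> N \<Longrightarrow> Z \<le> u n" and M: "\<And>n. n \<ge> M \<Longrightarrow> Z \<le> v n"
    using assms unfolding filterlim_at_top eventually_sequentially by metis
  show "\<forall>\<^sub>F n in sequentially. Z \<le> (if even n then u (n div 2) else v (n div 2))"
    unfolding eventually_sequentially
    by (rule exI[of _ "2 * (N + M)"]) (auto intro!: N M)
qed

section \<open>Averages of observables\<close>

context bykov_field
begin

text \<open>
  On the part of \<open>V\<close> away from \<open>s\<close>, the distance to the equilibria is bounded below, so a multiple of it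
  dominates the bounded function \<open>G - G s\<close>.
\<close>

lemma close_to_equilibrium_value:
  assumes G: "continuous_on S3 G" and V: "compact V" "V \<subseteq> S3"
    and s: "{s, s'} = {sigma1, sigma2}" "s' \<notin> V" and "e > 0"
  shows "\<exists>M. \<forall>y\<in>V. \<bar>G y - G s\<bar> \<le> e + M * eq_dist y"
proof -
  have sS: "s \<in> S3" using s(1) sigma_in_S3 by (auto simp: doubleton_eq_iff)
  obtain d where d: "d > 0" "\<And>y. y \<in> S3 \<Longrightarrow> dist y s < d \<Longrightarrow> dist (G y) (G s) < e"
    using G sS \<open>e > 0\<close> unfolding continuous_on_iff by blast
  have "bounded (G ` S3)" using G by (intro compact_imp_bounded compact_continuous_image) auto
  then obtain D where "\<forall>g\<in>G ` S3. norm g \<le> D" unfolding bounded_iff by blast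
  then have D: "\<bar>G y\<bar> \<le> D" if "y \<in> S3" for y using that by auto
  define K where "K = V - ball s d"
  have "\<exists>c>0. \<forall>y\<in>K. c \<le> eq_dist y"
  proof (cases "K = {}")
    case False
    have "compact K" unfolding K_def using V(1) by (intro compact_diff) auto
    moreover have "continuous_on K eq_dist" by (intro continuous_intros)
    ultimately obtain y0 where y0: "y0 \<in> K" "\<forall>y\<in>K. eq_dist y0 \<le> eq_dist y"
      using continuous_attains_inf[of K eq_dist] False by blast
    have "y0 \<notin> {sigma1, sigma2}"
      using y0(1) s d(1) by (auto simp: K_def doubleton_eq_iff)
    then have "eq_dist y0 > 0" by (intro infdist_pos_not_in_closed) auto
    then show ?thesis using y0(2) by blast
  qed (auto intro: exI[of _ 1])
  then obtain c where c: "c > 0" "\<And>y. y \<in> K \<Longrightarrow> c \<le> eq_dist y" by blast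
  have D0: "D \<ge> 0" using D[OF sS] by linarith
  have "\<bar>G y - G s\<bar> \<le> e + 2 * D / c * eq_dist y" if y: "y \<in> V" for y
  proof (cases "y \<in> K")
    case True
    have "\<bar>G y - G s\<bar> \<le> 2 * D" using D[of y] D[OF sS] y V(2) by fastforce
    also have "\<dots> = 2 * D / c * c" using c(1) by simp
    also have "\<dots> \<le> 2 * D / c * eq_dist y" using c D0 True by (intro mult_left_mono) auto
    finally show ?thesis using \<open>e > 0\<close> by linarith
  next
    case False
    then have "\<bar>G y - G s\<bar> < e"
      using d(2)[of y] y V(2) by (auto simp: K_def dist_commute dist_real_def)
    moreover have "0 \<le> 2 * D / c * eq_dist y"
      using D0 c(1) by (intro mult_nonneg_nonneg infdist_nonneg) auto
    ultimately show ?thesis by linarith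
  qed
  then show ?thesis by blast
qed

lemma flow_observable_continuous:
  assumes "continuous_on S3 G" "x \<in> S3"
  shows "continuous_on A (\<lambda>s. G (\<phi> s x))"
  by (rule continuous_on_compose2[OF assms(1) flow_continuous_on[OF assms(2)]])
    (use flow_in_S3[OF assms(2)] in auto)

text \<open>
  The estimate passes from the beginning to the end of a sojourn in \<open>V\<close> with unchanged constants, so it
  can be carried through any number of sojourns.
\<close>

lemma sojourn_integral:
  assumes G: "continuous_on S3 G" and x: "x \<in> S3" and "0 \<le> u" "u \<le> v"
    and M: "\<And>y. y \<in> V \<Longrightarrow> \<bar>G y - g\<bar> \<le> e + M * eq_dist y"
    and V: "\<And>t. u \<le> t \<Longrightarrow> t \<le> v \<Longrightarrow> \<phi> t x \<in> V"
    and bound: "\<bar>integral {0..u} (\<lambda>s. G (\<phi> s x)) - c\<bar>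
      \<le> e * u + M * integral {0..u} (\<lambda>s. eq_dist (\<phi> s x))"
  shows "\<bar>integral {0..v} (\<lambda>s. G (\<phi> s x)) - (c + g * (v - u))\<bar>
      \<le> e * v + M * integral {0..v} (\<lambda>s. eq_dist (\<phi> s x))"
proof -
  let ?G = "\<lambda>s. G (\<phi> s x)" and ?d = "\<lambda>s. eq_dist (\<phi> s x)"
  note cont = flow_observable_continuous[OF G x] flow_eq_dist_continuous[OF x]
  have "norm (integral {u..v} (\<lambda>s. ?G s - g)) \<le> integral {u..v} (\<lambda>s. e + M * ?d s)"
  proof (rule integral_norm_bound_integral)
    show "(\<lambda>s. ?G s - g) integrable_on {u..v}"
      by (intro integrable_continuous_real continuous_intros cont)
    show "(\<lambda>s. e + M * ?d s) integrable_on {u..v}"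
      by (intro integrable_continuous_real continuous_on_add continuous_on_mult continuous_on_const cont)
    show "norm (?G t - g) \<le> e + M * ?d t" if "t \<in> {u..v}" for t
      using M V that by simp
  qed
  also have "integral {u..v} (\<lambda>s. e + M * ?d s) = e * (v - u) + M * integral {u..v} ?d"
    using \<open>u \<le> v\<close> by (subst Henstock_Kurzweil_Integration.integral_add)
      (auto intro!: integrable_continuous_real continuous_on_add continuous_on_mult continuous_on_const cont)
  also have "integral {u..v} (\<lambda>s. ?G s - g) = integral {u..v} ?G - g * (v - u)"
    using \<open>u \<le> v\<close> by (subst Henstock_Kurzweil_Integration.integral_diff)
      (auto intro!: integrable_continuous_real continuous_intros cont)
  finally have "\<bar>integral {u..v} ?G - g * (v - u)\<bar> \<le> e * (v - u) + M * integral {u..v} ?d"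
    by simp
  moreover have "integral {0..v} ?G = integral {0..u} ?G + integral {u..v} ?G"
    "integral {0..v} ?d = integral {0..u} ?d + integral {u..v} ?d"
    using assms(3,4) by (intro integral_split cont; simp)+
  ultimately show ?thesis using bound by (simp add: algebra_simps)
qed

text \<open>
  As a property of one observable and one initial point, the assertion can be transported along
  trajectories and by the symmetry \<open>Gamma2\<close>.
\<close>

definition averages_oscillate :: "(real^4 \<Rightarrow> real) \<Rightarrow> real^4 \<Rightarrow> bool" where
  "averages_oscillate G x \<longleftrightarrow>
    (\<exists>t :: nat \<Rightarrow> real. filterlim t at_top sequentially \<and>
      (\<lambda>i. integral {0..t (2 * i)} (\<lambda>s. G (\<phi> s x)) / t (2 * i))
        \<longlonglongrightarrow> 1 / (1 + C1 / E2) * G sigma1 + (C1 / E2) / (1 + C1 / E2) * G sigma2 \<and>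
      (\<lambda>i. integral {0..t (2 * i + 1)} (\<lambda>s. G (\<phi> s x)) / t (2 * i + 1))
        \<longlonglongrightarrow> (C2 / E1) / (1 + C2 / E1) * G sigma1 + 1 / (1 + C2 / E1) * G sigma2)"

lemma averages_oscillate_shift:
  assumes G: "continuous_on S3 G" and x: "x \<in> S3" "u \<ge> 0"
    and osc: "averages_oscillate G (\<phi> u x)"
  shows "averages_oscillate G x"
proof -
  let ?I = "\<lambda>t. integral {0..t} (\<lambda>s. G (\<phi> s x))" and ?J = "\<lambda>t. integral {0..t} (\<lambda>s. G (\<phi> s (\<phi> u x)))"
  have IJ: "?I (u + t) = ?I u + ?J t" if "t \<ge> 0" for t
  proof -
    have "?I (u + t) = ?I u + integral {u..u + t} (\<lambda>s. G (\<phi> s x))"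
      using x(2) that by (intro integral_split flow_observable_continuous G x) auto
    also have "integral {u..u + t} (\<lambda>s. G (\<phi> s x)) = integral {0..t} (\<lambda>s. G (\<phi> (s + u) x))"
      using integral_shift_Icc_real[of 0 t "\<lambda>s. G (\<phi> s x)" u] by (simp add: o_def add.commute)
    finally show ?thesis by (simp add: flow_add[OF x(1)])
  qed
  have shift: "(\<lambda>i. ?I (u + t i) / (u + t i)) \<longlonglongrightarrow> l"
    if t: "filterlim t at_top sequentially" and l: "(\<lambda>i. ?J (t i) / t i) \<longlonglongrightarrow> l" for t l
  proof -
    have inf: "filterlim t at_infinity sequentially" using t by (rule filterlim_at_top_imp_at_infinity)
    have "(\<lambda>i. (?I u / t i + ?J (t i) / t i) / (u / t i + 1)) \<longlonglongrightarrow> (0 + l) / (0 + 1)"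
      by (intro tendsto_divide tendsto_add l tendsto_const tendsto_divide_0[OF tendsto_const inf]) simp
    moreover have "\<forall>\<^sub>F i in sequentially. ?I (u + t i) / (u + t i) = (?I u / t i + ?J (t i) / t i) / (u / t i + 1)"
    proof -
      have "\<forall>\<^sub>F i in sequentially. t i > 0" using t unfolding filterlim_at_top_dense by blast
      then show ?thesis
      proof eventually_elim
        case (elim i)
        have "(?I u / t i + ?J (t i) / t i) / (u / t i + 1) = ((?I u + ?J (t i)) / t i) / ((u + t i) / t i)"
          using elim by (simp add: add_divide_distrib)
        also have "\<dots> = (?I u + ?J (t i)) / (u + t i)" using elim by simp
        finally show ?case using IJ[of "t i"] elim by simp
      qed
    qed
    ultimately show ?thesis by (subst tendsto_cong) simp_all
  qed
  obtain t where t: "filterlim t at_top sequentially"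
      "(\<lambda>i. ?J (t (2 * i)) / t (2 * i))
        \<longlonglongrightarrow> 1 / (1 + C1 / E2) * G sigma1 + (C1 / E2) / (1 + C1 / E2) * G sigma2"
      "(\<lambda>i. ?J (t (2 * i + 1)) / t (2 * i + 1))
        \<longlonglongrightarrow> (C2 / E1) / (1 + C2 / E1) * G sigma1 + 1 / (1 + C2 / E1) * G sigma2"
    using osc unfolding averages_oscillate_def by blast
  have "filterlim (\<lambda>i. t (2 * i)) at_top sequentially" "filterlim (\<lambda>i. t (2 * i + 1)) at_top sequentially"
    by (rule filterlim_compose[OF t(1)], rule filterlim_subseq, simp add: strict_mono_def)+
  from shift[OF this(1) t(2)] shift[OF this(2) t(3)] show ?thesis
    unfolding averages_oscillate_def
    by (intro exI[of _ "\<lambda>i. u + t i"] conjI filterlim_tendsto_add_at_top[OF tendsto_const t(1)])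
qed

lemma averages_oscillate_Gamma2:
  assumes x: "x \<in> S3" and osc: "averages_oscillate (\<lambda>y. G (Gamma2 y)) (Gamma2 x)"
  shows "averages_oscillate G x"
  using osc unfolding averages_oscillate_def flow_Gamma2[OF x] by simp

lemma continuous_on_Gamma2_compose:
  assumes "continuous_on S3 G"
  shows "continuous_on S3 (\<lambda>y. G (Gamma2 y))"
  by (rule continuous_on_compose2[OF assms linear_continuous_on])
    (use linear_Gamma2 in \<open>auto simp: linear_conv_bounded_linear\<close>)

text \<open>
  The fourth coordinate is \<open>1\<close> at \<open>sigma1\<close> and \<open>- 1\<close> at \<open>sigma2\<close>. For it, equality of the two limits would
  mean \<open>C1 / E2 * (C2 / E1) = 1\<close>, but this product is greater than \<open>1\<close>.
\<close>

lemma oscillation_implies_historic: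
  assumes "\<And>G. continuous_on S3 G \<Longrightarrow> averages_oscillate G x"
  shows "historic \<phi> x"
proof -
  let ?G = "\<lambda>y :: real^4. y $ 4"
  let ?c = "C1 / E2" and ?d = "C2 / E1"
  have G: "continuous_on S3 ?G" by (intro continuous_intros)
  obtain t where t: "filterlim t at_top sequentially"
      "(\<lambda>i. integral {0..t (2 * i)} (\<lambda>s. ?G (\<phi> s x)) / t (2 * i))
        \<longlonglongrightarrow> 1 / (1 + ?c) * ?G sigma1 + ?c / (1 + ?c) * ?G sigma2"
      "(\<lambda>i. integral {0..t (2 * i + 1)} (\<lambda>s. ?G (\<phi> s x)) / t (2 * i + 1))
        \<longlonglongrightarrow> ?d / (1 + ?d) * ?G sigma1 + 1 / (1 + ?d) * ?G sigma2"
    using assms[OF G] unfolding averages_oscillate_def by blast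
  have "\<not> (\<exists>L. (time_average \<phi> ?G x \<longlongrightarrow> L) at_top)"
  proof
    assume "\<exists>L. (time_average \<phi> ?G x \<longlongrightarrow> L) at_top"
    then obtain L where L: "(time_average \<phi> ?G x \<longlongrightarrow> L) at_top" ..
    have "filterlim (\<lambda>i. t (2 * i)) at_top sequentially" "filterlim (\<lambda>i. t (2 * i + 1)) at_top sequentially"
      by (rule filterlim_compose[OF t(1)], rule filterlim_subseq, simp add: strict_mono_def)+
    from filterlim_compose[OF L this(1)] filterlim_compose[OF L this(2)]
    have "1 / (1 + ?c) * ?G sigma1 + ?c / (1 + ?c) * ?G sigma2 = L"
      "?d / (1 + ?d) * ?G sigma1 + 1 / (1 + ?d) * ?G sigma2 = L"
      using LIMSEQ_unique[OF t(2)] LIMSEQ_unique[OF t(3)] by (simp_all add: time_average_def)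
    then have eq: "1 / (1 + ?c) - ?c / (1 + ?c) = ?d / (1 + ?d) - 1 / (1 + ?d)"
      by (simp add: sigma1_def sigma2_def vector_4)
    have pos: "?c > 0" "?d > 0" using P2_constants by simp_all
    have "(1 - ?c) / (1 + ?c) = (?d - 1) / (1 + ?d)"
      using eq by (simp only: diff_divide_distrib)
    then have "(1 - ?c) * (1 + ?d) = (?d - 1) * (1 + ?c)"
      using pos by (simp add: frac_eq_eq)
    moreover have "(1 - c) * (1 + d) = (d - 1) * (1 + c) \<Longrightarrow> c * d = 1" for c d :: real by algebra
    ultimately have "?c * ?d = 1" by blast
    moreover have "?c * ?d > 1"
    proof -
      have "E2 * E1 < C2 * C1" using P2_constants by (intro mult_strict_mono) auto
      then show ?thesis using P2_constants by (simp add: field_simps)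
    qed
    ultimately show False by linarith
  qed
  then show ?thesis using G unfolding historic_def by blast
qed

end

section \<open>The itinerary of a basin trajectory\<close>

context bykov_coordinates
begin

text \<open>
  The passage through the first cylinder and the transition to the second one, from coordinates
  \<open>(\<theta>, z)\<close> on the wall to coordinates \<open>(\<theta>, \<rho>)\<close> on the top disc; \<open>return1\<close> is the way back.
\<close>

definition exit1 :: "real \<times> real \<Rightarrow> real \<times> real" where
  "exit1 q = (- (\<omega>1 / E1) * ln (snd q) + fst q + S2 q, snd q powr (C1 / E1) + S1 q)"

definition return1 :: "real \<times> real \<Rightarrow> real \<times> real" where
  "return1 p = (h (- (\<omega>2 / E2) * ln (snd p) + fst p + T1 p), a * (snd p powr (C2 / E2) + T2 p))"

definition wall_point :: "real \<times> real \<Rightarrow> real^4" where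
  "wall_point q = \<psi>1 (rcis 1 (fst q), snd q)"

definition top_point :: "real \<times> real \<Rightarrow> real^4" where
  "top_point p = \<psi>2 (rcis (snd p) (fst p), 1)"

text \<open>
  The exit radius is positive, because a trajectory through the centre of the top disc lies on the
  network.
\<close>

lemma passage_sigma1:
  assumes "0 < snd q" "snd q < 1" and off: "wall_point q \<notin> network \<phi>"
  shows "0 < snd (exit1 q)" "snd (exit1 q) < 1"
    and "\<phi> (- ln (snd q) / E1) (wall_point q) = top_point (exit1 q)"
    and "\<And>t. 0 \<le> t \<Longrightarrow> t \<le> - ln (snd q) / E1 \<Longrightarrow> \<phi> t (wall_point q) \<in> \<psi>1 ` cyl"
proof -
  obtain \<theta> z where q: "q = (\<theta>, z)" by (cases q)
  let ?\<rho> = "z powr (C1 / E1) + S1 (\<theta>, z)" and ?\<alpha> = "- (\<omega>1 / E1) * ln z + \<theta> + S2 (\<theta>, z)"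
  have z: "z \<in> {0<..<1}" using assms by (simp add: q)
  note p = passage1[rule_format, OF z, of \<theta>]
  have \<rho>: "0 \<le> ?\<rho>" "?\<rho> < 1" using p by auto
  have ex: "\<phi> (- ln z / E1) (\<psi>1 (rcis 1 \<theta>, z)) = \<psi>1 (rcis ?\<rho> ?\<alpha>, 1)"
    using p by (simp add: passage_def)
  have inS: "wall_point q \<in> S3"
    using cylinder_chartD(3)[OF chart1] z by (auto simp: wall_point_def q cyl_iff image_subset_iff)
  have "?\<rho> \<noteq> 0"
  proof
    assume "?\<rho> = 0"
    then have "\<psi>1 (rcis ?\<rho> ?\<alpha>, 1) \<in> Fix Gamma1"
      by (subst cylinder_chartD(6)[OF chart1]) (auto simp: cyl_iff)
    then have "wall_point q \<in> network \<phi>"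
      using flow_in_network_iff[OF inS, of "- ln z / E1"] ex by (simp add: wall_point_def q network_eq)
    then show False using off by simp
  qed
  then show "0 < snd (exit1 q)" "snd (exit1 q) < 1" using \<rho> by (simp_all add: exit1_def q)
  have "\<psi>1 (rcis ?\<rho> ?\<alpha>, 1) = \<psi>2 (rcis ?\<rho> ?\<alpha>, 1)" using transition12 \<rho> by simp
  then show "\<phi> (- ln (snd q) / E1) (wall_point q) = top_point (exit1 q)"
    using ex by (simp add: exit1_def q wall_point_def top_point_def)
  show "\<phi> t (wall_point q) \<in> \<psi>1 ` cyl" if "0 \<le> t" "t \<le> - ln (snd q) / E1" for t
    using p that by (simp add: passage_def wall_point_def q)
qed

lemma passage_sigma2:
  assumes "0 < snd p" "snd p < 1"
  shows "0 < snd (return1 p)" "snd (return1 p) < a"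
    and "\<phi> (- ln (snd p) / E2) (top_point p) = wall_point (return1 p)"
    and "\<And>t. 0 \<le> t \<Longrightarrow> t \<le> - ln (snd p) / E2 \<Longrightarrow> \<phi> t (top_point p) \<in> \<psi>2 ` cyl"
proof -
  obtain \<theta> \<rho> where p: "p = (\<theta>, \<rho>)" by (cases p)
  let ?z = "\<rho> powr (C2 / E2) + T2 (\<theta>, \<rho>)" and ?\<beta> = "- (\<omega>2 / E2) * ln \<rho> + \<theta> + T1 (\<theta>, \<rho>)"
  have \<rho>: "\<rho> \<in> {0<..<1}" using assms by (simp add: p)
  note q = passage2[rule_format, OF \<rho>, of \<theta>]
  have z: "0 < ?z" "?z < 1" using q by auto
  show "0 < snd (return1 p)" "snd (return1 p) < a" using z a_range by (simp_all add: return1_def p)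
  have "\<psi>2 (rcis 1 ?\<beta>, ?z) = \<psi>1 (rcis 1 (h ?\<beta>), a * ?z)" using transition21 z by simp
  then show "\<phi> (- ln (snd p) / E2) (top_point p) = wall_point (return1 p)"
    using q by (simp add: passage_def return1_def p wall_point_def top_point_def)
  show "\<phi> t (top_point p) \<in> \<psi>2 ` cyl" if "0 \<le> t" "t \<le> - ln (snd p) / E2" for t
    using q that by (simp add: passage_def top_point_def p)
qed

text \<open>
  Otherwise some entry points would accumulate at a point of the wall with \<open>z > 0\<close>. This would be a
  point of the network, but a point of the network in the cylinder has \<open>w = 0\<close> or \<open>z = 0\<close>.
\<close>

lemma wall_heights_tendsto_0:
  assumes x: "x \<in> proper_basin \<phi>" and T: "filterlim T at_top sequentially"
    and q: "\<And>k. \<phi> (T k) x = wall_point (q k)" "\<And>k. 0 < snd (q k)" "\<And>k. snd (q k) < 1"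
  shows "(\<lambda>k. snd (q k)) \<longlonglongrightarrow> 0"
proof (rule ccontr)
  assume "\<not> ?thesis"
  then obtain e where e: "e > 0" "\<exists>\<^sub>F k in sequentially. e \<le> snd (q k)"
    using q(2) unfolding tendsto_iff dist_real_def not_eventually[symmetric]
    by (auto simp: not_less abs_of_pos not_eventually)
  then have "infinite {k. e \<le> snd (q k)}"
    by (simp add: cofinite_eq_sequentially[symmetric] frequently_cofinite)
  then obtain j :: "nat \<Rightarrow> nat" where j: "strict_mono j" "\<And>n. e \<le> snd (q (j n))"
    using infinite_enumerate by blast
  let ?c = "\<lambda>n. (rcis 1 (fst (q (j n))), snd (q (j n)))"
  have "compact (sphere (0::complex) 1 \<times> {e..1})" by (intro compact_Times) auto
  then have cpt: "seq_compact (sphere (0::complex) 1 \<times> {e..1})" by (rule compact_imp_seq_compact)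
  have mem: "?c n \<in> sphere 0 1 \<times> {e..1}" for n
    using j(2) q(3)[of "j n"] by auto
  obtain w i where w: "w \<in> sphere 0 1 \<times> {e..1}" "strict_mono i" "(?c \<circ> i) \<longlonglongrightarrow> w"
    by (rule seq_compactE[OF cpt allI[OF mem]])
  have wc: "w \<in> cyl" using w(1) e(1) by (auto simp: cyl_def)
  have "(?c \<circ> i) n \<in> cyl" for n
    using j(2)[of "i n"] q(3)[of "j (i n)"] e(1) by (auto simp: cyl_iff)
  then have "(\<lambda>n. \<psi>1 ((?c \<circ> i) n)) \<longlonglongrightarrow> \<psi>1 w"
    using cylinder_chartD(2)[OF chart1] w(3) wc by (auto simp: continuous_on_sequentially o_def)
  then have "(\<lambda>n. \<phi> (T (j (i n))) x) \<longlonglongrightarrow> \<psi>1 w"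
    by (simp add: q(1) wall_point_def)
  moreover have "filterlim (\<lambda>n. T (j (i n))) at_top sequentially"
    using filterlim_compose[OF T filterlim_subseq[OF strict_mono_o[OF j(1) w(2)]]] by (simp add: o_def)
  ultimately have "\<psi>1 w \<in> network \<phi>"
    using basin_cases(3)[OF x] unfolding omega_limit_def by blast
  then show False
    using cylinder_chartD(6,7)[OF chart1, of "fst w" "snd w"] wc w(1) e(1)
    by (auto simp: network_eq)
qed

text \<open>
  Sojourn times are logarithms of entry heights and radii, up to the factors \<open>- 1 / E1\<close> and \<open>- 1 / E2\<close>,
  and each passage map is a small perturbation of a power; hence the limits of the quotients.
\<close>

lemma itinerary:
  assumes x: "x \<in> proper_basin \<phi>" "x \<in> In_sigma1"
  shows "\<exists>\<tau> s :: nat \<Rightarrow> real. (\<forall>k. \<tau> k > 0 \<and> s k > 0) \<and>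
     (\<forall>n t. (\<Sum>k<n. \<tau> k) + (\<Sum>k<n. s k) \<le> t \<longrightarrow> t \<le> (\<Sum>k<Suc n. \<tau> k) + (\<Sum>k<n. s k) \<longrightarrow>
        \<phi> t x \<in> \<psi>1 ` cyl) \<and>
     (\<forall>n t. (\<Sum>k<Suc n. \<tau> k) + (\<Sum>k<n. s k) \<le> t \<longrightarrow> t \<le> (\<Sum>k<Suc n. \<tau> k) + (\<Sum>k<Suc n. s k) \<longrightarrow>
        \<phi> t x \<in> \<psi>2 ` cyl) \<and>
     filterlim (\<lambda>n. \<Sum>k<n. \<tau> k) at_top sequentially \<and>
     (\<lambda>k. s k / \<tau> k) \<longlonglongrightarrow> C1 / E2 \<and> (\<lambda>k. \<tau> (Suc k) / s k) \<longlonglongrightarrow> C2 / E1"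
proof -
  note xb = basin_cases[OF x(1)]
  note E = P2_constants(4,6)
  obtain q0 where q0: "x = wall_point q0" "0 < snd q0" "snd q0 < 1"
    using x(2) by (force simp: In_sigma1_def wall_point_def)
  define q where "q k = ((return1 \<circ> exit1) ^^ k) q0" for k
  define p where "p k = exit1 (q k)" for k
  have q_Suc: "q (Suc k) = return1 (p k)" for k by (simp add: q_def p_def)
  define \<tau> where "\<tau> k = - ln (snd (q k)) / E1" for k
  define s where "s k = - ln (snd (p k)) / E2" for k
  let ?A = "\<lambda>n. \<Sum>k<n. \<tau> k" and ?B = "\<lambda>n. \<Sum>k<n. s k"
  have step: "0 < snd (p k)" "snd (p k) < 1" "\<phi> (\<tau> k) (wall_point (q k)) = top_point (p k)"
      "\<And>t. 0 \<le> t \<Longrightarrow> t \<le> \<tau> k \<Longrightarrow> \<phi> t (wall_point (q k)) \<in> \<psi>1 ` cyl"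
    if "0 < snd (q k)" "snd (q k) < 1" "\<phi> (?A k + ?B k) x = wall_point (q k)" for k
  proof -
    have "wall_point (q k) \<notin> network \<phi>"
      using xb that(3) flow_in_network_iff by metis
    from passage_sigma1[OF that(1,2) this]
    show "0 < snd (p k)" "snd (p k) < 1" "\<phi> (\<tau> k) (wall_point (q k)) = top_point (p k)"
      "\<And>t. 0 \<le> t \<Longrightarrow> t \<le> \<tau> k \<Longrightarrow> \<phi> t (wall_point (q k)) \<in> \<psi>1 ` cyl"
      by (simp_all add: p_def \<tau>_def)
  qed
  have main: "0 < snd (q k) \<and> snd (q k) < 1 \<and> \<phi> (?A k + ?B k) x = wall_point (q k)" for k
  proof (induction k)
    case 0
    then show ?case using q0 xb(1) by (simp add: q_def)
  next
    case (Suc k)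
    then have S: "0 < snd (q k)" "snd (q k) < 1" "\<phi> (?A k + ?B k) x = wall_point (q k)" by auto
    note st = step[OF S]
    have "?A (Suc k) + ?B (Suc k) = s k + (\<tau> k + (?A k + ?B k))" by simp
    then have "\<phi> (?A (Suc k) + ?B (Suc k)) x = \<phi> (s k) (\<phi> (\<tau> k) (\<phi> (?A k + ?B k) x))"
      by (simp only: flow_add[OF xb(1)])
    also have "\<dots> = \<phi> (s k) (top_point (p k))" by (simp only: S(3) st(3))
    also have "\<dots> = wall_point (q (Suc k))"
      unfolding q_Suc s_def by (rule passage_sigma2(3)[OF st(1,2)])
    finally have "\<phi> (?A (Suc k) + ?B (Suc k)) x = wall_point (q (Suc k))" .
    then show ?case using passage_sigma2(1,2)[OF st(1,2)] a_range by (simp add: q_Suc)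
  qed
  have q: "0 < snd (q k)" "snd (q k) < 1" "\<phi> (?A k + ?B k) x = wall_point (q k)" for k
    using main[of k] by auto
  note pk = step[OF q]
  have pos: "\<tau> k > 0" "s k > 0" for k
    using q(1,2)[of k] pk(1,2)[of k] E by (simp_all add: \<tau>_def s_def divide_neg_pos)
  have V1: "\<phi> t x \<in> \<psi>1 ` cyl" if t: "?A n + ?B n \<le> t" "t \<le> ?A (Suc n) + ?B n" for n t
  proof -
    have "\<phi> (t - (?A n + ?B n)) (wall_point (q n)) \<in> \<psi>1 ` cyl"
      using t by (intro pk(4)) simp_all
    then show ?thesis by (simp only: q(3)[symmetric] flow_add[OF xb(1)] diff_add_cancel)
  qed
  have top: "\<phi> (?A (Suc n) + ?B n) x = top_point (p n)" for n
  proof -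
    have "?A (Suc n) + ?B n = \<tau> n + (?A n + ?B n)" by simp
    then have "\<phi> (?A (Suc n) + ?B n) x = \<phi> (\<tau> n) (\<phi> (?A n + ?B n) x)"
      by (simp only: flow_add[OF xb(1)])
    then show ?thesis by (simp only: q(3) pk(3))
  qed
  have V2: "\<phi> t x \<in> \<psi>2 ` cyl" if t: "?A (Suc n) + ?B n \<le> t" "t \<le> ?A (Suc n) + ?B (Suc n)" for n t
  proof -
    have "\<phi> (t - (?A (Suc n) + ?B n)) (top_point (p n)) \<in> \<psi>2 ` cyl"
      using t by (intro passage_sigma2(4)[OF pk(1,2), folded s_def]) simp_all
    then show ?thesis by (simp only: top[symmetric] flow_add[OF xb(1)] diff_add_cancel)
  qed
  have A_top: "filterlim ?A at_top sequentially"
  proof -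
    define c where "c = - ln a / E1"
    have "c > 0" using a_range E by (simp add: c_def divide_neg_pos)
    \<comment> \<open>Each return takes place below height \<open>a < 1\<close>, so the next sojourn is not shorter than \<open>c\<close>.\<close>
    have \<tau>c: "\<tau> (Suc k) \<ge> c" for k
      using passage_sigma2(1,2)[OF pk(1,2), of k] E
      by (simp add: \<tau>_def c_def q_Suc divide_right_mono)
    have lower: "c * (- 1 + real n) \<le> ?A n" for n
    proof (induction n)
      case 0
      then show ?case using \<open>c > 0\<close> by simp
    next
      case (Suc n)
      then show ?case
        using pos(1)[of 0] \<tau>c[of "n - 1"] \<open>c > 0\<close> by (cases n) (auto simp: algebra_simps)
    qed
    have linear: "filterlim (\<lambda>n. c * (- 1 + real n)) at_top sequentially"
      using \<open>c > 0\<close> by (intro filterlim_tendsto_pos_mult_at_top[OF tendsto_const]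
          filterlim_tendsto_add_at_top[OF tendsto_const] filterlim_real_sequentially)
    show ?thesis by (intro filterlim_at_top_mono[OF linear] always_eventually allI lower)
  qed
  have "?B n \<ge> 0" for n by (intro sum_nonneg less_imp_le pos(2))
  then have "filterlim (\<lambda>n. ?A n + ?B n) at_top sequentially"
    by (intro filterlim_at_top_mono[OF A_top] always_eventually allI) simp
  then have z0: "(\<lambda>k. snd (q k)) \<longlonglongrightarrow> 0"
    by (rule wall_heights_tendsto_0[OF x(1) _ q(3) q(1) q(2)])
  have \<delta>: "C1 / E1 > 0" "C2 / E2 > 0" using P2_constants by simp_all
  have grow: "d < d * (1 + \<epsilon>)" if "d > 0" for d using that eps by (simp add: algebra_simps)
  have lt: "C1 / E1 < C1 / E1 * (1 + \<epsilon>)" "C2 / E2 < C2 / E2 * (1 + \<epsilon>)"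
    by (rule grow[OF \<delta>(1)], rule grow[OF \<delta>(2)])
  note ratio1 = log_ratio_of_perturbed_power[OF remainders(1) \<delta>(1) lt(1) zero_less_one q(1) z0,
      of "\<lambda>k. snd (p k)" "\<lambda>k. fst (q k)"]
  have r1: "(\<lambda>k. ln (snd (p k)) / ln (snd (q k))) \<longlonglongrightarrow> C1 / E1" "(\<lambda>k. snd (p k)) \<longlonglongrightarrow> 0"
    by (rule ratio1; simp add: p_def exit1_def)+
  note ratio2 = log_ratio_of_perturbed_power[OF remainders(4) \<delta>(2) lt(2) a_range(1) pk(1) r1(2),
      of "\<lambda>k. snd (q (Suc k))" "\<lambda>k. fst (p k)"]
  have r2: "(\<lambda>k. ln (snd (q (Suc k))) / ln (snd (p k))) \<longlonglongrightarrow> C2 / E2"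
    by (rule ratio2(1); simp add: q_Suc return1_def)
  have "(\<lambda>k. ln (snd (p k)) / ln (snd (q k)) * (E1 / E2)) \<longlonglongrightarrow> C1 / E1 * (E1 / E2)"
    by (intro tendsto_intros r1(1))
  then have "(\<lambda>k. s k / \<tau> k) \<longlonglongrightarrow> C1 / E2"
    using E by (simp add: s_def \<tau>_def mult.commute)
  moreover have "(\<lambda>k. ln (snd (q (Suc k))) / ln (snd (p k)) * (E2 / E1)) \<longlonglongrightarrow> C2 / E2 * (E2 / E1)"
    by (intro tendsto_intros r2)
  then have "(\<lambda>k. \<tau> (Suc k) / s k) \<longlonglongrightarrow> C2 / E1"
    using E by (simp add: s_def \<tau>_def mult.commute)
  ultimately show ?thesis
    using pos V1 V2 A_top by (intro exI[of _ \<tau>] exI[of _ s]) blast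
qed

end

section \<open>Oscillation of the averages\<close>

context bykov_coordinates
begin

text \<open>
  The ends of the sojourns near \<open>sigma2\<close> and of those near \<open>sigma1\<close> give the two limits. In both cases
  \<open>weighted_average_limit\<close> applies, with the roles of the two equilibria exchanged.
\<close>

lemma averages_oscillate_from_section:
  assumes x: "x \<in> proper_basin \<phi>" "x \<in> In_sigma1" and G: "continuous_on S3 G"
  shows "averages_oscillate G x"
proof -
  note xb = basin_cases[OF x(1)]
  obtain \<tau> s :: "nat \<Rightarrow> real" where pos: "\<And>k. \<tau> k > 0" "\<And>k. s k > 0"
    and V1: "\<And>n t. (\<Sum>k<n. \<tau> k) + (\<Sum>k<n. s k) \<le> t \<Longrightarrow> t \<le> (\<Sum>k<Suc n. \<tau> k) + (\<Sum>k<n. s k) \<Longrightarrow>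
        \<phi> t x \<in> \<psi>1 ` cyl"
    and V2: "\<And>n t. (\<Sum>k<Suc n. \<tau> k) + (\<Sum>k<n. s k) \<le> t \<Longrightarrow> t \<le> (\<Sum>k<Suc n. \<tau> k) + (\<Sum>k<Suc n. s k) \<Longrightarrow>
        \<phi> t x \<in> \<psi>2 ` cyl"
    and A_top0: "filterlim (\<lambda>n. \<Sum>k<n. \<tau> k) at_top sequentially"
    and ratio: "(\<lambda>k. s k / \<tau> k) \<longlonglongrightarrow> C1 / E2" "(\<lambda>k. \<tau> (Suc k) / s k) \<longlonglongrightarrow> C2 / E1"
    using itinerary[OF x] by blast
  define A B where "A n = (\<Sum>k<n. \<tau> k)" and "B n = (\<Sum>k<n. s k)" for n
  let ?I = "\<lambda>t. integral {0..t} (\<lambda>s. G (\<phi> s x))" and ?D = "\<lambda>t. integral {0..t} (\<lambda>s. eq_dist (\<phi> s x))"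
  have A0: "A 0 = 0" "B 0 = 0" by (simp_all add: A_def B_def)
  have A_Suc: "A (Suc n) = A n + \<tau> n" "B (Suc n) = B n + s n" for n by (simp_all add: A_def B_def)
  have nonneg: "A n \<ge> 0" "B n \<ge> 0" for n
    unfolding A_def B_def by (intro sum_nonneg less_imp_le pos)+
  have gpos: "C1 / E2 > 0" "C2 / E1 > 0" using P2_constants by simp_all
  have A_top: "filterlim A at_top sequentially"
    using A_top0 by (simp add: A_def[abs_def])
  have BA: "(\<lambda>n. B n / A n) \<longlonglongrightarrow> C1 / E2"
    unfolding A_def B_def by (rule stolz_cesaro_ratio[OF pos(1) A_top0 ratio(1)])
  have B_top: "filterlim B at_top sequentially"
  proof -
    have "filterlim (\<lambda>n. B n / A n * A n) at_top sequentially"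
      by (rule filterlim_tendsto_pos_mult_at_top[OF BA gpos(1) A_top])
    moreover have "B n / A n * A n = B n" for n
    proof (cases n)
      case 0
      then show ?thesis by (simp add: A0)
    next
      case (Suc m)
      then show ?thesis using nonneg(1)[of m] pos(1)[of m] by (simp add: A_Suc)
    qed
    ultimately show ?thesis by simp
  qed
  have AB: "(\<lambda>n. A (Suc n) / B n) \<longlonglongrightarrow> C2 / E1"
  proof -
    \<comment> \<open>The sojourn \<open>\<tau> 0\<close> has no predecessor near \<open>sigma2\<close>; it is a negligible constant.\<close>
    have "(\<lambda>n. (\<Sum>k<n. \<tau> (Suc k)) / B n) \<longlonglongrightarrow> C2 / E1"
      unfolding B_def by (rule stolz_cesaro_ratio[OF pos(2) B_top[unfolded B_def[abs_def]] ratio(2)])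
    moreover have "(\<lambda>n. \<tau> 0 / B n) \<longlonglongrightarrow> 0"
      by (rule tendsto_divide_0[OF tendsto_const filterlim_at_top_imp_at_infinity[OF B_top]])
    ultimately have "(\<lambda>n. \<tau> 0 / B n + (\<Sum>k<n. \<tau> (Suc k)) / B n) \<longlonglongrightarrow> 0 + C2 / E1"
      by (intro tendsto_add)
    then show ?thesis unfolding A_def sum.lessThan_Suc_shift by (simp add: add_divide_distrib)
  qed
  have even_top: "filterlim (\<lambda>n. A n + B n) at_top sequentially"
    by (intro filterlim_at_top_mono[OF A_top] always_eventually allI) (simp add: nonneg)
  have odd_top: "filterlim (\<lambda>n. A (Suc n) + B n) at_top sequentially"
    by (intro filterlim_at_top_mono[OF B_top] always_eventually allI) (simp add: nonneg)
  have err: "\<exists>M. \<forall>n. \<bar>?I (A n + B n) - (G sigma1 * A n + G sigma2 * B n)\<bar>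
        \<le> e * (A n + B n) + M * ?D (A n + B n) \<and>
      \<bar>?I (A (Suc n) + B n) - (G sigma1 * A (Suc n) + G sigma2 * B n)\<bar>
        \<le> e * (A (Suc n) + B n) + M * ?D (A (Suc n) + B n)" if "e > 0" for e
  proof -
    obtain M1 where M1: "\<And>y. y \<in> \<psi>1 ` cyl \<Longrightarrow> \<bar>G y - G sigma1\<bar> \<le> e + M1 * eq_dist y"
      using close_to_equilibrium_value[OF G cylinder_chart_closed(1)[OF chart1] cylinder_chartD(3)[OF chart1]
          refl sigma_not_in_other_cylinder(1) \<open>e > 0\<close>] by blast
    obtain M2 where M2: "\<And>y. y \<in> \<psi>2 ` cyl \<Longrightarrow> \<bar>G y - G sigma2\<bar> \<le> e + M2 * eq_dist y"
      using close_to_equilibrium_value[OF G cylinder_chart_closed(1)[OF chart2] cylinder_chartD(3)[OF chart2]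
          insert_commute sigma_not_in_other_cylinder(2) \<open>e > 0\<close>] by blast
    define M where "M = max M1 M2"
    have le: "M1 * eq_dist y \<le> M * eq_dist y" "M2 * eq_dist y \<le> M * eq_dist y" for y
      by (intro mult_right_mono infdist_nonneg; simp add: M_def)+
    have M: "\<And>y. y \<in> \<psi>1 ` cyl \<Longrightarrow> \<bar>G y - G sigma1\<bar> \<le> e + M * eq_dist y"
      "\<And>y. y \<in> \<psi>2 ` cyl \<Longrightarrow> \<bar>G y - G sigma2\<bar> \<le> e + M * eq_dist y"
      using M1 M2 le by (meson add_left_mono order_trans)+
    let ?even = "\<lambda>n. \<bar>?I (A n + B n) - (G sigma1 * A n + G sigma2 * B n)\<bar>
        \<le> e * (A n + B n) + M * ?D (A n + B n)"
    let ?odd = "\<lambda>n. \<bar>?I (A (Suc n) + B n) - (G sigma1 * A (Suc n) + G sigma2 * B n)\<bar>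
        \<le> e * (A (Suc n) + B n) + M * ?D (A (Suc n) + B n)"
    have odd: "?odd n" if "?even n" for n
    proof -
      have "A n + B n \<le> A (Suc n) + B n" using pos(1)[of n] by (simp add: A_Suc)
      from sojourn_integral[OF G xb(1) _ this M(1) _ that]
      have "\<bar>?I (A (Suc n) + B n) - (G sigma1 * A n + G sigma2 * B n +
          G sigma1 * (A (Suc n) + B n - (A n + B n)))\<bar> \<le> e * (A (Suc n) + B n) + M * ?D (A (Suc n) + B n)"
        using nonneg V1[of n, folded A_def B_def] by simp
      then show ?thesis by (simp add: algebra_simps)
    qed
    have even_Suc: "?even (Suc n)" if "?odd n" for n
    proof -
      have "A (Suc n) + B n \<le> A (Suc n) + B (Suc n)" using pos(2)[of n] by (simp add: A_Suc)
      from sojourn_integral[OF G xb(1) _ this M(2) _ that]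
      have "\<bar>?I (A (Suc n) + B (Suc n)) - (G sigma1 * A (Suc n) + G sigma2 * B n +
          G sigma2 * (A (Suc n) + B (Suc n) - (A (Suc n) + B n)))\<bar>
          \<le> e * (A (Suc n) + B (Suc n)) + M * ?D (A (Suc n) + B (Suc n))"
        using nonneg V2[of n, folded A_def B_def] by simp
      then show ?thesis by (simp add: algebra_simps)
    qed
    have "?even n" for n
      by (induction n) (use odd even_Suc in \<open>auto simp: A0\<close>)
    then show ?thesis using odd by blast
  qed
  have D0: "((\<lambda>t. ?D t / t) \<longlongrightarrow> 0) at_top" by (rule eq_dist_average_tendsto_0[OF xb(1,3)])
  have even: "(\<lambda>n. ?I (A n + B n) / (A n + B n))
      \<longlonglongrightarrow> 1 / (1 + C1 / E2) * G sigma1 + (C1 / E2) / (1 + C1 / E2) * G sigma2"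
  proof (rule weighted_average_limit[OF A_top BA gpos(1) filterlim_compose[OF D0 even_top]])
    show "\<exists>M. \<forall>n. \<bar>?I (A n + B n) - (G sigma1 * A n + G sigma2 * B n)\<bar>
        \<le> e * (A n + B n) + M * ?D (A n + B n)" if "e > 0" for e
      using err[OF that] by blast
  qed
  have odd: "(\<lambda>n. ?I (A (Suc n) + B n) / (B n + A (Suc n)))
      \<longlonglongrightarrow> 1 / (1 + C2 / E1) * G sigma2 + (C2 / E1) / (1 + C2 / E1) * G sigma1"
  proof (rule weighted_average_limit[OF B_top AB gpos(2)])
    show "(\<lambda>n. ?D (A (Suc n) + B n) / (B n + A (Suc n))) \<longlonglongrightarrow> 0"
      using filterlim_compose[OF D0 odd_top] by (simp add: add.commute)
    show "\<exists>M. \<forall>n. \<bar>?I (A (Suc n) + B n) - (G sigma2 * B n + G sigma1 * A (Suc n))\<bar>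
        \<le> e * (B n + A (Suc n)) + M * ?D (A (Suc n) + B n)" if "e > 0" for e
      using err[OF that] by (simp only: add.commute[of "B _"] add.commute[of "G sigma2 * _"]) blast
  qed
  \<comment> \<open>Even indices end sojourns near \<open>sigma2\<close>, odd indices those near \<open>sigma1\<close>. Since \<open>t 0 = 0\<close>, the
    first average is \<open>0\<close> by the convention on division, which does not affect the limit.\<close>
  define t where "t n = (if even n then A (n div 2) + B (n div 2) else A (Suc (n div 2)) + B (n div 2))"
    for n :: nat
  have "filterlim t at_top sequentially"
    unfolding t_def[abs_def] by (rule filterlim_at_top_interleave[OF even_top odd_top])
  moreover have "t (2 * i) = A i + B i" "t (2 * i + 1) = A (Suc i) + B i" for i
    by (simp_all add: t_def)
  ultimately show ?thesis
    unfolding averages_oscillate_def using even odd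
    by (intro exI[of _ t] conjI) (simp_all only: add.commute[of "B _"] add.commute[of "_ * G sigma2"])
qed

lemma averages_oscillate_on_basin:
  assumes P: "P \<in> proper_basin \<phi>" and G: "continuous_on S3 G"
  shows "averages_oscillate G P"
proof -
  have PS: "P \<in> S3" by (rule basin_cases(1)[OF P])
  obtain u where u: "u \<ge> 0" "\<phi> u P \<in> In_sigma1 \<or> Gamma2 (\<phi> u P) \<in> In_sigma1"
    using reaches_In_sigma1[OF P] by blast
  note Q = basin_flow[OF P, of u]
  have "averages_oscillate G (\<phi> u P)"
  proof (cases "\<phi> u P \<in> In_sigma1")
    case True
    then show ?thesis by (rule averages_oscillate_from_section[OF Q _ G])
  next
    case False
    then have "Gamma2 (\<phi> u P) \<in> In_sigma1" using u(2) by blast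
    then have "averages_oscillate (\<lambda>y. G (Gamma2 y)) (Gamma2 (\<phi> u P))"
      by (rule averages_oscillate_from_section[OF basin_Gamma2[OF Q] _ continuous_on_Gamma2_compose[OF G]])
    then show ?thesis by (rule averages_oscillate_Gamma2[OF flow_in_S3[OF PS]])
  qed
  then show ?thesis by (rule averages_oscillate_shift[OF G PS u(1)])
qed

end

theorem proposition5p1:
  fixes r :: nat
    and f :: "real^4 \<Rightarrow> real^4"
    and \<phi> :: "real \<Rightarrow> real^4 \<Rightarrow> real^4"
    and C1 \<omega>1 E1 C2 \<omega>2 E2 :: real
    and \<psi>1 \<psi>2 :: "complex \<times> real \<Rightarrow> real^4"
    and S1 S2 T1 T2 :: "real \<times> real \<Rightarrow> real"
    and \<epsilon> a \<gamma>1 \<gamma>2 :: real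
    and h :: "real \<Rightarrow> real"
  assumes "bykov_coordinates r f \<phi> C1 \<omega>1 E1 C2 \<omega>2 E2 \<psi>1 \<psi>2 S1 S2 T1 T2 \<epsilon> a h"
    and "\<gamma>1 = C1 / E2"
    and "\<gamma>2 = C2 / E1"
  shows "(\<forall>G :: real^4 \<Rightarrow> real. \<forall>P. continuous_on S3 G \<and> P \<in> proper_basin \<phi> \<longrightarrow>
           (\<exists>t :: nat \<Rightarrow> real. filterlim t at_top sequentially \<and>
              (\<lambda>i. (1 / t (2 * i)) * integral {0..t (2 * i)} (\<lambda>s. G (\<phi> s P)))
                \<longlonglongrightarrow> 1 / (1 + \<gamma>1) * G sigma1 + \<gamma>1 / (1 + \<gamma>1) * G sigma2 \<and>
              (\<lambda>i. (1 / t (2 * i + 1)) * integral {0..t (2 * i + 1)} (\<lambda>s. G (\<phi> s P)))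
                \<longlonglongrightarrow> \<gamma>2 / (1 + \<gamma>2) * G sigma1 + 1 / (1 + \<gamma>2) * G sigma2))
         \<and> (\<forall>P \<in> proper_basin \<phi>. historic \<phi> P)"
proof -
  interpret bykov_coordinates r f \<phi> C1 \<omega>1 E1 C2 \<omega>2 E2 \<psi>1 \<psi>2 S1 S2 T1 T2 \<epsilon> a h
    by (rule assms(1))
  have times: "1 / t * integral S g = integral S g / t" for t :: real and S and g :: "real \<Rightarrow> real"
    by simp
  show ?thesis
    unfolding times assms(2,3) averages_oscillate_def[symmetric]
    using averages_oscillate_on_basin oscillation_implies_historic by blast
qed

end
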